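(* Let $m,n\in\mathbf{N}$ and let $\phi^{(m^n)}$ be the Foulkes character. (i) If $m$ is even, then the unique minimal constituent of $\phi^{(m^n)}$ is $\chi^{(m^n)}$. (ii) If $m$ is odd, then for a partition $\lambda$ of $mn$, $\chi^\lambda$ is a minimal constituent of $\phi^{(m^n)}$ if and only if there is a minimal set family of shape $(m^n)$ and type $\lambda$.
   Context: $\phi^{(m^n)}$ is the permutation character of $S_{mn}$ acting on the set partitions of $\{1,\dots,mn\}$ into $n$ sets each of size $m$. For a partition $\lambda$, $\chi^\lambda$ is the ordinary irreducible character of the symmetric group afforded by the Specht module $S^\lambda\otimes\mathbf{Q}$. For a character $\pi$ of $S_r$, $\chi^\lambda$ is a minimal constituent of $\pi$ if $\langle\pi,\chi^\lambda\rangle\ge 1$ and $\langle\pi,\chi^\mu\rangle=0$ for all partitions $\mu\lhd\lambda$ (strictly smaller in the dominance order). A set family of shape $(m^n)$ is a collection of $n$ distinct $m$-subsets of $\mathbf{N}=\{1,2,\dots\}$. If $\lambda$ is a partition with largest part $a$, a set family has type $\lambda$ if for each $i\in\{1,\dots,a\}$ exactly $\lambda'_i$ of its sets contain $i$ ($\lambda'$ the conjugate partition). A set family of shape $(m^n)$ and type $\lambda$ is minimal if there is no set family of shape $(m^n)$ and type $\mu$ with $\mu\lhd\lambda$. *)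

theory Defs
  imports "HOL-Analysis.Analysis" "HOL-Library.Function_Algebras"
    "HOL-Library.Disjoint_Sets" "HOL-Combinatorics.Permutations"
begin

definition is_partition :: "nat list \<Rightarrow> bool" where
  "is_partition lam \<longleftrightarrow> sorted_wrt (\<ge>) lam \<and> (\<forall>x\<in>set lam. 0 < x)"

definition partition_of :: "nat \<Rightarrow> nat list \<Rightarrow> bool" where
  "partition_of r lam \<longleftrightarrow> is_partition lam \<and> sum_list lam = r"

definition dominated :: "nat list \<Rightarrow> nat list \<Rightarrow> bool" where
  "dominated mu lam \<longleftrightarrow> sum_list mu = sum_list lam \<and>
     (\<forall>k. sum_list (take k mu) \<le> sum_list (take k lam))"

definition strictly_dominated :: "nat list \<Rightarrow> nat list \<Rightarrow> bool" where
  "strictly_dominated mu lam \<longleftrightarrow> dominated mu lam \<and> mu \<noteq> lam"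

text \<open>Conjugate partition, 1-indexed: conj_part lam i = lam'_i.\<close>
definition conj_part :: "nat list \<Rightarrow> nat \<Rightarrow> nat" where
  "conj_part lam i = card {j. j < length lam \<and> i \<le> lam ! j}"

definition largest_part :: "nat list \<Rightarrow> nat" where
  "largest_part lam = Max (insert 0 (set lam))"

definition cells :: "nat list \<Rightarrow> (nat \<times> nat) set" where
  "cells lam = {(i, j). i < length lam \<and> j < lam ! i}"

definition tableaux :: "nat list \<Rightarrow> ((nat \<times> nat) \<Rightarrow> nat) set" where
  "tableaux lam = {T. bij_betw T (cells lam) {1..sum_list lam}}"

text \<open>A tabloid is encoded as the map sending each entry to its row index
  (and everything outside 1..r to 0).\<close>
definition tabloid_of :: "nat list \<Rightarrow> ((nat \<times> nat) \<Rightarrow> nat) \<Rightarrow> nat \<Rightarrow> nat" where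
  "tabloid_of lam T = (\<lambda>x. if x \<in> {1..sum_list lam}
       then fst (the_inv_into (cells lam) T x) else 0)"

definition col_group :: "nat list \<Rightarrow> ((nat \<times> nat) \<Rightarrow> nat) \<Rightarrow> (nat \<Rightarrow> nat) set" where
  "col_group lam T = {p. p permutes {1..sum_list lam} \<and>
     (\<forall>c\<in>cells lam. snd (the_inv_into (cells lam) T (p (T c))) = snd c)}"

text \<open>Vectors of the permutation module M^lam: real-valued functions on tabloids.\<close>
type_synonym mvec = "(nat \<Rightarrow> nat) \<Rightarrow> real"

definition mscale :: "real \<Rightarrow> mvec \<Rightarrow> mvec" where
  "mscale c v = (\<lambda>f. c * v f)"

definition polytabloid :: "nat list \<Rightarrow> ((nat \<times> nat) \<Rightarrow> nat) \<Rightarrow> mvec" where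
  "polytabloid lam T = (\<lambda>f. \<Sum>p\<in>col_group lam T.
      of_int (sign p) * (if tabloid_of lam (p \<circ> T) = f then 1 else 0))"

text \<open>Specht module (over the reals; same character as over Q).\<close>
definition specht :: "nat list \<Rightarrow> mvec set" where
  "specht lam = module.span mscale (polytabloid lam ` tableaux lam)"

text \<open>Action of a permutation s on M^lam: delta_f goes to delta_{f o inv s}.\<close>
definition perm_act :: "(nat \<Rightarrow> nat) \<Rightarrow> mvec \<Rightarrow> mvec" where
  "perm_act s v = (\<lambda>f. v (f \<circ> s))"

definition specht_basis :: "nat list \<Rightarrow> mvec set" where
  "specht_basis lam = (SOME B. finite B \<and> B \<subseteq> specht lam \<and>
      \<not> module.dependent mscale B \<and> module.span mscale B = specht lam)"

definition irr_char :: "nat list \<Rightarrow> (nat \<Rightarrow> nat) \<Rightarrow> real" where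
  "irr_char lam s = (\<Sum>b\<in>specht_basis lam.
      module.representation mscale (specht_basis lam) (perm_act s b) b)"

definition char_inner :: "nat \<Rightarrow> ((nat \<Rightarrow> nat) \<Rightarrow> real) \<Rightarrow> ((nat \<Rightarrow> nat) \<Rightarrow> real) \<Rightarrow> real" where
  "char_inner r chi psi = (\<Sum>s\<in>{s. s permutes {1..r}}. chi s * psi s) / fact r"

definition set_partitions_mn :: "nat \<Rightarrow> nat \<Rightarrow> nat set set set" where
  "set_partitions_mn m n = {P. partition_on {1..m*n} P \<and> card P = n \<and> (\<forall>X\<in>P. card X = m)}"

definition foulkes_char :: "nat \<Rightarrow> nat \<Rightarrow> (nat \<Rightarrow> nat) \<Rightarrow> real" where
  "foulkes_char m n s = real (card {P\<in>set_partitions_mn m n. (\<lambda>X. s ` X) ` P = P})"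

definition minimal_constituent :: "nat \<Rightarrow> ((nat \<Rightarrow> nat) \<Rightarrow> real) \<Rightarrow> nat list \<Rightarrow> bool" where
  "minimal_constituent r ch lam \<longleftrightarrow>
     char_inner r ch (irr_char lam) \<ge> 1 \<and>
     (\<forall>mu. partition_of r mu \<longrightarrow> strictly_dominated mu lam \<longrightarrow> char_inner r ch (irr_char mu) = 0)"

definition set_family :: "nat \<Rightarrow> nat \<Rightarrow> nat set set \<Rightarrow> bool" where
  "set_family m n F \<longleftrightarrow> finite F \<and> card F = n \<and>
     (\<forall>X\<in>F. finite X \<and> card X = m \<and> X \<subseteq> {1..})"

definition has_type :: "nat set set \<Rightarrow> nat list \<Rightarrow> bool" where
  "has_type F lam \<longleftrightarrow> (\<forall>i\<in>{1..largest_part lam}. card {X\<in>F. i \<in> X} = conj_part lam i)"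

definition minimal_set_family :: "nat \<Rightarrow> nat \<Rightarrow> nat set set \<Rightarrow> nat list \<Rightarrow> bool" where
  "minimal_set_family m n F lam \<longleftrightarrow> set_family m n F \<and> has_type F lam \<and>
     \<not> (\<exists>G mu. is_partition mu \<and> strictly_dominated mu lam \<and> set_family m n G \<and> has_type G mu)"

end

theory Submission
  imports Defs
begin

text \<open>Let \<open>K\<close> be the stabilizer of a set partition \<open>P\<close> of shape \<open>(m^n)\<close>. The multiplicity of the
  character of a Specht module \<open>S\<close> in the Foulkes character is the dimension of the \<open>K\<close>-invariants
  of \<open>S\<close>. If it is nonzero, then some column group of the given shape meets \<open>K\<close> in even permutations
  only. Hence each block of \<open>P\<close> meets each column at most once, and for odd \<open>m\<close> no two blocks occupy
  the same set of columns, since interchanging them would be an odd permutation; so the blocks give a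
  set family of that type.

  Conversely, let the signed column sum \<open>w\<close> of the indicator function of \<open>K\<close> be nonzero, while moving
  any point to an earlier column annihilates it. This is the case for minimal types and, when \<open>m\<close> is
  even, for the rectangle. Then \<open>w\<close> is an eigenvector of the sum of all transpositions. Among the
  row labellings whose symmetrizer does not annihilate \<open>w\<close>, one with the most pairs of points in a
  common row yields another eigenvector. Equality of the two eigenvalues forces rows and columns to
  form a Young diagram of the given shape, so that a nonzero \<open>K\<close>-invariant exists in the Specht module
  of precisely this shape. No completeness theorem for Specht modules is needed.\<close>

section \<open>Signed sums over Young subgroups\<close>

text \<open>A vector satisfying the column relations could a priori generate constituents of several
  shapes; the difficulty is to show that the prescribed shape itself occurs. The sum of all
  transpositions is suited to this because it is central, so the eigenvalue of \<open>w\<close>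
  survives row symmetrization. Annihilation under moves to earlier columns is a relation of Garnir
  type: the transpositions of a point with the points of one earlier column sum to the scalar 1 on
  \<open>w\<close>, while those inside a column act as -1, so the eigenvalue depends on the column
  labels alone. Maximality of the row labelling gives the dual relations with opposite signs. On a
  Young diagram both eigenvalues are \<open>r\<close> plus twice the sum of the contents (column
  index minus row index). In general no two points share both row and column, which bounds the
  number of pairs in common rows by column indices and the number in common columns by row indices;
  equal eigenvalues mean that all these bounds are attained. For the indicator function of
  \<open>K\<close> the hypotheses become parity questions about permutations preserving both blocks
  and labels.\<close>

abbreviation swap :: "nat \<Rightarrow> nat \<Rightarrow> nat \<Rightarrow> nat" where
  "swap \<equiv> Transposition.transpose"

text \<open>The Boolean selects the sign or the trivial character, so that columns and rows share
  all proofs.\<close>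

definition perm_weight :: "bool \<Rightarrow> (nat \<Rightarrow> nat) \<Rightarrow> real" where
  "perm_weight b p = (if b then of_int (sign p) else 1)"

definition young :: "nat \<Rightarrow> (nat \<Rightarrow> nat) \<Rightarrow> (nat \<Rightarrow> nat) set" where
  "young r c = {p. p permutes {1..r} \<and> (\<forall>x\<in>{1..r}. c (p x) = c x)}"

text \<open>This is a group algebra element acting through \<open>perm_act\<close>. Vectors are
  functions on all maps, so the same calculus serves functions on tabloids and functions on
  permutations.\<close>

definition young_sum :: "bool \<Rightarrow> nat \<Rightarrow> (nat \<Rightarrow> nat) \<Rightarrow> mvec \<Rightarrow> mvec" where
  "young_sum b r c v = (\<lambda>f. \<Sum>p\<in>young r c. perm_weight b p * v (f \<circ> p))"

lemma permutation_interval: "p permutes {1..r::nat} \<Longrightarrow> permutation p"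
  using permutation_permutes by blast

lemma perm_weight_id [simp]: "perm_weight b id = 1"
  by (simp add: perm_weight_def)

lemma perm_weight_comp:
  assumes "p permutes {1..r}" "q permutes {1..r}"
  shows "perm_weight b (p \<circ> q) = perm_weight b p * perm_weight b q"
  using assms by (simp add: perm_weight_def sign_compose permutation_interval)

lemma perm_weight_inv:
  assumes "p permutes {1..r}"
  shows "perm_weight b (inv p) = perm_weight b p"
  using assms by (simp add: perm_weight_def sign_inverse permutation_interval)

lemma perm_weight_square [simp]: "perm_weight b p * perm_weight b p = 1"
  by (auto simp: perm_weight_def sign_def)

lemma finite_permutes: "finite {p. p permutes {1..r::nat}}"
  by (simp add: finite_permutations)

lemma finite_young: "finite (young r c)"
  by (rule finite_subset[OF _ finite_permutes[of r]]) (auto simp: young_def)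

lemma young_permutes: "p \<in> young r c \<Longrightarrow> p permutes {1..r}"
  by (simp add: young_def)

lemma id_in_young: "id \<in> young r c"
  by (simp add: young_def permutes_id)

lemma permutes_mem: "p permutes S \<Longrightarrow> x \<in> S \<Longrightarrow> p x \<in> S"
  by (simp add: permutes_in_image)

lemma young_comp:
  assumes "p \<in> young r c" "q \<in> young r c"
  shows "p \<circ> q \<in> young r c"
  unfolding young_def mem_Collect_eq
proof (intro conjI ballI)
  show "p \<circ> q permutes {1..r}"
    using permutes_compose[OF young_permutes young_permutes] assms by blast
next
  fix x assume x: "x \<in> {1..r}"
  have "q x \<in> {1..r}" using permutes_mem[OF young_permutes[OF assms(2)] x] .
  then show "c ((p \<circ> q) x) = c x" using assms x by (simp add: young_def)
qed

lemma young_inv: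
  assumes "p \<in> young r c"
  shows "inv p \<in> young r c"
proof -
  have p: "p permutes {1..r}" using assms by (rule young_permutes)
  have "c (inv p x) = c x" if "x \<in> {1..r}" for x
  proof -
    have "inv p x \<in> {1..r}" using permutes_mem[OF permutes_inv[OF p] that] .
    then have "c (p (inv p x)) = c (inv p x)" using assms by (simp add: young_def)
    then show ?thesis using permutes_inverses(1)[OF p] by simp
  qed
  then show ?thesis using permutes_inv[OF p] by (simp add: young_def)
qed

lemma comp_inv_cancel:
  assumes "p permutes S"
  shows "f \<circ> p \<circ> inv p = f" "f \<circ> inv p \<circ> p = f"
    "p \<circ> (inv p \<circ> g) = g" "inv p \<circ> (p \<circ> g) = g"
  using permutes_inverses[OF assms] by (auto simp: fun_eq_iff)

lemma transpose_in_young: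
  assumes "x \<in> {1..r}" "y \<in> {1..r}" "c x = c y"
  shows "swap x y \<in> young r c"
  using assms permutes_swap_id[of x "{1..r}" y] by (auto simp: young_def Transposition.transpose_def)

lemma perm_weight_transpose:
  "x \<noteq> y \<Longrightarrow> perm_weight b (swap x y) = (if b then -1 else 1)"
  by (simp add: perm_weight_def sign_swap_id)

text \<open>Absorption of a factor on the right of the group algebra element;
  \<open>perm_act_young_sum\<close> is absorption on the left.\<close>

lemma young_sum_perm_act_absorb:
  assumes q: "q \<in> young r c"
  shows "young_sum b r c (perm_act q v) f = perm_weight b q * young_sum b r c v f"
proof -
  have q': "q permutes {1..r}" using q by (rule young_permutes)
  have "young_sum b r c (perm_act q v) f = (\<Sum>p\<in>young r c. perm_weight b p * v (f \<circ> p \<circ> q))"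
    by (simp add: young_sum_def perm_act_def comp_assoc)
  also have "\<dots> = (\<Sum>p\<in>young r c. perm_weight b (p \<circ> inv q) * v (f \<circ> p))"
    by (rule sum.reindex_bij_witness[of _ "\<lambda>p. p \<circ> inv q" "\<lambda>p. p \<circ> q"])
      (use q young_comp young_inv in \<open>auto simp: comp_inv_cancel[OF q'] comp_assoc[symmetric]\<close>)
  also have "\<dots> = perm_weight b q * young_sum b r c v f"
    unfolding young_sum_def sum_distrib_left
  proof (rule sum.cong[OF refl])
    fix p assume "p \<in> young r c"
    then have "perm_weight b (p \<circ> inv q) = perm_weight b p * perm_weight b q"
      using perm_weight_comp[OF young_permutes permutes_inv[OF q']] perm_weight_inv[OF q']
      by metis
    then show "perm_weight b (p \<circ> inv q) * v (f \<circ> p) = perm_weight b q * (perm_weight b p * v (f \<circ> p))"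
      by simp
  qed
  finally show ?thesis .
qed

lemma perm_act_young_sum:
  assumes q: "q \<in> young r c"
  shows "young_sum b r c v (f \<circ> q) = perm_weight b q * young_sum b r c v f"
proof -
  have q': "q permutes {1..r}" using q by (rule young_permutes)
  have "young_sum b r c v (f \<circ> q) = (\<Sum>p\<in>young r c. perm_weight b p * v (f \<circ> (q \<circ> p)))"
    by (simp add: young_sum_def comp_assoc)
  also have "\<dots> = (\<Sum>p\<in>young r c. perm_weight b (inv q \<circ> p) * v (f \<circ> p))"
    by (rule sum.reindex_bij_witness[of _ "\<lambda>p. inv q \<circ> p" "\<lambda>p. q \<circ> p"])
      (use q young_comp young_inv in \<open>auto simp: comp_inv_cancel[OF q']\<close>)
  also have "\<dots> = perm_weight b q * young_sum b r c v f"
    unfolding young_sum_def sum_distrib_left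
  proof (rule sum.cong[OF refl])
    fix p assume "p \<in> young r c"
    then have "perm_weight b (inv q \<circ> p) = perm_weight b q * perm_weight b p"
      using perm_weight_comp[OF permutes_inv[OF q'] young_permutes] perm_weight_inv[OF q']
      by metis
    then show "perm_weight b (inv q \<circ> p) * v (f \<circ> p) = perm_weight b q * (perm_weight b p * v (f \<circ> p))"
      by simp
  qed
  finally show ?thesis .
qed

section \<open>Conjugating a labelling and changing one label\<close>

lemma young_conj:
  assumes g: "g permutes {1..r}" and q: "q \<in> young r (c \<circ> g)"
  shows "g \<circ> q \<circ> inv g \<in> young r c"
proof -
  have q': "q permutes {1..r}" using q by (rule young_permutes)
  have "c (g (q (inv g x))) = c x" if x: "x \<in> {1..r}" for x
  proof -
    have "inv g x \<in> {1..r}" using permutes_mem[OF permutes_inv[OF g] x] .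
    then have "c (g (q (inv g x))) = c (g (inv g x))" using q by (simp add: young_def)
    then show ?thesis using permutes_inverses(1)[OF g] by simp
  qed
  then show ?thesis
    using permutes_compose[OF permutes_inv[OF g] permutes_compose[OF q' g]]
    by (simp add: young_def comp_assoc)
qed

text \<open>Conjugation by \<open>g\<close> carries the Young subgroup of \<open>c \<circ> g\<close>
  onto that of \<open>c\<close> and preserves signs.\<close>

lemma young_sum_perm_act:
  assumes g: "g permutes {1..r}"
  shows "young_sum b r c (perm_act g v) = perm_act g (young_sum b r (c \<circ> g) v)"
proof
  fix f
  have g': "inv g permutes {1..r}" using permutes_inv[OF g] .
  have gg: "inv (inv g) = g" using permutes_inv_inv[OF g] .
  have conj_back: "inv g \<circ> p \<circ> g \<in> young r (c \<circ> g)" if "p \<in> young r c" for p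
  proof -
    have "c \<circ> g \<circ> inv g = c" using comp_inv_cancel(1)[OF g] .
    then have "p \<in> young r ((c \<circ> g) \<circ> inv g)" using that by simp
    from young_conj[OF g' this] show ?thesis by (simp add: gg)
  qed
  have "young_sum b r c (perm_act g v) f = (\<Sum>p\<in>young r c. perm_weight b p * v (f \<circ> p \<circ> g))"
    by (simp add: young_sum_def perm_act_def)
  also have "\<dots> = (\<Sum>q\<in>young r (c \<circ> g). perm_weight b q * v (f \<circ> g \<circ> q))"
  proof (rule sum.reindex_bij_witness[of _ "\<lambda>q. g \<circ> q \<circ> inv g" "\<lambda>p. inv g \<circ> p \<circ> g"])
    fix p assume p: "p \<in> young r c"
    have "perm_weight b (inv g \<circ> p \<circ> g) = perm_weight b p"
      using perm_weight_comp[OF permutes_compose[OF young_permutes[OF p] g'] g, of b]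
        perm_weight_comp[OF g' young_permutes[OF p], of b] perm_weight_inv[OF g, of b]
        perm_weight_square[of b g]
      by (simp add: mult.commute mult.left_commute)
    moreover have "f \<circ> g \<circ> (inv g \<circ> p \<circ> g) = f \<circ> p \<circ> g"
      by (simp add: comp_inv_cancel(1)[OF g] comp_assoc[symmetric])
    ultimately show "perm_weight b (inv g \<circ> p \<circ> g) * v (f \<circ> g \<circ> (inv g \<circ> p \<circ> g)) =
        perm_weight b p * v (f \<circ> p \<circ> g)" by simp
  qed (use young_conj[OF g] conj_back in \<open>auto simp: comp_assoc permutes_inv_o[OF g] comp_inv_cancel(3,4)[OF g]\<close>)
  also have "\<dots> = perm_act g (young_sum b r (c \<circ> g) v) f"
    by (simp add: young_sum_def perm_act_def)
  finally show "young_sum b r c (perm_act g v) f = perm_act g (young_sum b r (c \<circ> g) v) f" .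
qed

text \<open>The stabilizer \<open>?D\<close> of \<open>x\<close> lies in the Young subgroups of both
  labellings. Its cosets in the new one are represented by the transpositions of \<open>x\<close>
  with its possible images, and \<open>v\<close> transforms under \<open>?D\<close> by the weight,
  so each coset contributes equally often.\<close>

lemma young_sum_split:
  fixes v :: mvec
  assumes x: "x \<in> {1..r}" and i: "i \<noteq> c x"
    and v: "\<And>d f. d \<in> young r c \<Longrightarrow> v (f \<circ> d) = perm_weight b d * v f"
  shows "young_sum b r (c(x := i)) v f = card {d \<in> young r c. d x = x} *
    (v f + (if b then -1 else 1) * (\<Sum>y\<in>{y\<in>{1..r}. c y = i}. v (f \<circ> swap x y)))"
proof -
  let ?D = "{d \<in> young r c. d x = x}"
  let ?Y = "{y\<in>{1..r}. c y = i}"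
  let ?c = "c(x := i)"
  have Yx: "x \<notin> ?Y" using i by auto
  have D: "d \<in> young r ?c" if "d \<in> ?D" for d
  proof -
    have "d permutes {1..r}" using that by (simp add: young_def)
    then have "d y = x \<longleftrightarrow> y = x" for y using that by (metis (mono_tags, lifting) mem_Collect_eq permutes_inv_eq)
    then show ?thesis using that by (auto simp: young_def)
  qed
  have tr: "swap x y \<in> young r ?c" if "y \<in> insert x ?Y" for y
    by (rule transpose_in_young) (use x that i in auto)
  have "young_sum b r ?c v f = (\<Sum>p\<in>young r ?c. perm_weight b p * v (f \<circ> p))"
    by (simp add: young_sum_def)
  also have "\<dots> = (\<Sum>(y,d)\<in>insert x ?Y \<times> ?D. perm_weight b (swap x y \<circ> d) * v (f \<circ> swap x y \<circ> d))"
  proof (rule sum.reindex_bij_witness[of _ "\<lambda>(y,d). swap x y \<circ> d" "\<lambda>p. (p x, swap x (p x) \<circ> p)"])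
    fix p assume p: "p \<in> young r ?c"
    have pp: "p permutes {1..r}" using p by (rule young_permutes)
    have px: "p x \<in> {1..r}" using permutes_mem[OF pp x] .
    have cpx: "?c (p x) = i" using p x by (simp add: young_def)
    then have y: "p x \<in> insert x ?Y" using px by (auto split: if_splits)
    have t: "swap x (p x) \<circ> p \<in> young r ?c" using young_comp[OF tr[OF y] p] .
    have tx: "(swap x (p x) \<circ> p) x = x" by simp
    have tp: "swap x (p x) \<circ> p permutes {1..r}" using t by (rule young_permutes)
    have "c ((swap x (p x) \<circ> p) z) = c z" if z: "z \<in> {1..r}" for z
    proof (cases "z = x")
      case True then show ?thesis using tx by simp
    next
      case False
      then have "(swap x (p x) \<circ> p) z \<noteq> x" using tx permutes_inj[OF tp] by (metis injD)
      moreover have "?c ((swap x (p x) \<circ> p) z) = ?c z"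
        using t z unfolding young_def by blast
      ultimately show ?thesis using False by (metis fun_upd_other)
    qed
    then have "swap x (p x) \<circ> p \<in> ?D" using tp tx by (simp add: young_def)
    then show "(p x, swap x (p x) \<circ> p) \<in> insert x ?Y \<times> ?D" using y by simp
    show "(case (p x, swap x (p x) \<circ> p) of (y, d) \<Rightarrow> swap x y \<circ> d) = p"
      by (auto simp: fun_eq_iff)
    show "(case (p x, swap x (p x) \<circ> p) of (y, d) \<Rightarrow>
        perm_weight b (swap x y \<circ> d) * v (f \<circ> swap x y \<circ> d)) = perm_weight b p * v (f \<circ> p)"
    proof -
      have "swap x (p x) \<circ> (swap x (p x) \<circ> p) = p" by (auto simp: fun_eq_iff)
      moreover from this have "f \<circ> swap x (p x) \<circ> (swap x (p x) \<circ> p) = f \<circ> p"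
        by (metis comp_assoc)
      ultimately show ?thesis by (metis (no_types, lifting) case_prod_conv)
    qed
  next
    fix yd assume yd: "yd \<in> insert x ?Y \<times> ?D"
    obtain y d where [simp]: "yd = (y, d)" by (cases yd)
    have "d x = x" using yd by auto
    then show "((case yd of (y, d) \<Rightarrow> swap x y \<circ> d) x,
        swap x ((case yd of (y, d) \<Rightarrow> swap x y \<circ> d) x) \<circ> (case yd of (y, d) \<Rightarrow> swap x y \<circ> d)) = yd"
      by (auto simp: fun_eq_iff)
    show "(case yd of (y, d) \<Rightarrow> swap x y \<circ> d) \<in> young r ?c"
      using yd young_comp[OF tr D] by auto
  qed
  also have "\<dots> = (\<Sum>(y,d)\<in>insert x ?Y \<times> ?D. perm_weight b (swap x y) * v (f \<circ> swap x y))"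
  proof (rule sum.cong[OF refl], clarify)
    fix y d assume y: "y \<in> insert x ?Y" and d: "d \<in> young r c" "d x = x"
    have "perm_weight b (swap x y \<circ> d) = perm_weight b (swap x y) * perm_weight b d"
      by (rule perm_weight_comp[OF young_permutes[OF tr[OF y]] young_permutes[OF d(1)]])
    moreover have "v (f \<circ> swap x y \<circ> d) = perm_weight b d * v (f \<circ> swap x y)"
      using v[OF d(1)] by simp
    ultimately show "perm_weight b (swap x y \<circ> d) * v (f \<circ> swap x y \<circ> d) =
        perm_weight b (swap x y) * v (f \<circ> swap x y)"
      using perm_weight_square[of b d] by (simp add: mult.assoc mult.left_commute)
  qed
  also have "\<dots> = card ?D * (\<Sum>y\<in>insert x ?Y. perm_weight b (swap x y) * v (f \<circ> swap x y))"
    by (simp add: sum.cartesian_product[symmetric] sum_distrib_left)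
  also have "(\<Sum>y\<in>insert x ?Y. perm_weight b (swap x y) * v (f \<circ> swap x y)) =
      v f + (\<Sum>y\<in>?Y. perm_weight b (swap x y) * v (f \<circ> swap x y))"
    using Yx by (subst sum.insert) auto
  also have "(\<Sum>y\<in>?Y. perm_weight b (swap x y) * v (f \<circ> swap x y)) =
      (if b then -1 else 1) * (\<Sum>y\<in>?Y. v (f \<circ> swap x y))"
    unfolding sum_distrib_left
    by (rule sum.cong[OF refl], subst perm_weight_transpose) (use i in auto)
  finally show ?thesis .
qed

text \<open>Only the classes of equal labels matter, so they may be renumbered freely.\<close>

lemma young_kernel_cong:
  assumes "\<And>x y. x \<in> {1..r} \<Longrightarrow> y \<in> {1..r} \<Longrightarrow> c x = c y \<longleftrightarrow> c' x = c' y"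
  shows "young r c = young r c'"
  unfolding young_def
proof (rule Collect_cong, rule conj_cong[OF refl], rule ball_cong[OF refl])
  fix p x assume "p permutes {1..r}" "x \<in> {1..r}"
  then show "c (p x) = c x \<longleftrightarrow> c' (p x) = c' x" using assms permutes_mem by metis
qed

lemma young_sum_cong:
  assumes "\<And>x. x \<in> {1..r} \<Longrightarrow> c x = c' x"
  shows "young_sum b r c = young_sum b r c'"
  using young_kernel_cong[of r c c'] assms by (simp add: young_sum_def fun_eq_iff)

lemma young_sum_swap:
  "young_sum b r c (young_sum b' r c' u) f =
    (\<Sum>d\<in>young r c'. perm_weight b' d * young_sum b r c (perm_act d u) f)"
  unfolding young_sum_def perm_act_def sum_distrib_left comp_assoc
  by (subst sum.swap) (simp add: mult.left_commute)

text \<open>Carries the relations from \<open>u\<close> over to \<open>young_sum b r c u\<close>: a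
  permutation preserving \<open>c\<close> moves \<open>x\<close> within its own class, so
  conjugating \<open>c(x := i)\<close> gives another labelling covered by
  \<open>lower\<close>.\<close>

lemma young_sum_lower_zero:
  assumes lower: "\<And>x i. x \<in> {1..r} \<Longrightarrow> i < c x \<Longrightarrow> young_sum b r (c(x := i)) u = (\<lambda>_. 0)"
    and x: "x \<in> {1..r}" "i < c x"
  shows "young_sum b r (c(x := i)) (young_sum b r c u) = (\<lambda>_. 0)"
proof
  fix f
  have "young_sum b r (c(x := i)) (perm_act d u) f = 0" if d: "d \<in> young r c" for d
  proof -
    have dp: "d permutes {1..r}" using d by (rule young_permutes)
    let ?x = "inv d x"
    have x': "?x \<in> {1..r}" using permutes_mem[OF permutes_inv[OF dp] x(1)] .
    have dx: "d ?x = x" using permutes_inverses(1)[OF dp] .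
    have "c ?x = c x" using d x' dx unfolding young_def by force
    then have "young_sum b r (c(?x := i)) u = (\<lambda>_. 0)" using lower[OF x'] x(2) by simp
    moreover have "young_sum b r (c(x := i) \<circ> d) = young_sum b r (c(?x := i))"
    proof (rule young_sum_cong)
      fix y assume y: "y \<in> {1..r}"
      have "d y = x \<longleftrightarrow> y = ?x" using dx permutes_inverses(2)[OF dp] by metis
      then show "(c(x := i) \<circ> d) y = (c(?x := i)) y" using d y by (auto simp: young_def)
    qed
    ultimately show ?thesis
      using young_sum_perm_act[OF dp, of b "c(x := i)" u] by (simp add: perm_act_def)
  qed
  then show "young_sum b r (c(x := i)) (young_sum b r c u) f = 0"
    by (simp add: young_sum_swap)
qed

section \<open>The sum of all transpositions\<close>

text \<open>The sum over ordered pairs counts each transposition twice and includes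
  \<open>x = y\<close>; these diagonal terms contribute the summand \<open>r\<close> of every
  eigenvalue.\<close>

definition transposition_sum :: "nat \<Rightarrow> mvec \<Rightarrow> mvec" where
  "transposition_sum r v = (\<lambda>f. \<Sum>x\<in>{1..r}. \<Sum>y\<in>{1..r}. v (f \<circ> swap x y))"

definition same_label_pairs :: "nat \<Rightarrow> (nat \<Rightarrow> nat) \<Rightarrow> nat" where
  "same_label_pairs r c = (\<Sum>x\<in>{1..r}. card {y\<in>{1..r}. y \<noteq> x \<and> c y = c x})"

lemma transposition_sum_perm_act:
  assumes p: "p permutes {1..r}"
  shows "transposition_sum r (perm_act p v) = perm_act p (transposition_sum r v)"
proof
  fix f
  have sw: "swap (p x) (p y) \<circ> p = p \<circ> swap x y" for x y
    using permutes_inj[OF p] by (auto simp: fun_eq_iff Transposition.transpose_def inj_eq)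
  have bij: "bij_betw p {1..r} {1..r}" using p by (rule permutes_imp_bij)
  have "transposition_sum r (perm_act p v) f = (\<Sum>x\<in>{1..r}. \<Sum>y\<in>{1..r}. v (f \<circ> swap x y \<circ> p))"
    by (simp add: transposition_sum_def perm_act_def)
  also have "\<dots> = (\<Sum>x\<in>{1..r}. \<Sum>y\<in>{1..r}. v (f \<circ> swap (p x) (p y) \<circ> p))"
    by (subst sum.reindex_bij_betw[OF bij, symmetric],
        subst (2) sum.reindex_bij_betw[OF bij, symmetric]) (rule refl)
  also have "\<dots> = perm_act p (transposition_sum r v) f"
    by (simp add: transposition_sum_def perm_act_def comp_assoc sw)
  finally show "transposition_sum r (perm_act p v) f = perm_act p (transposition_sum r v) f" .
qed

lemma transposition_sum_young_sum:
  "transposition_sum r (young_sum b r c v) = young_sum b r c (transposition_sum r v)"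
proof
  fix f
  have "transposition_sum r (young_sum b r c v) f =
      (\<Sum>p\<in>young r c. perm_weight b p * transposition_sum r (perm_act p v) f)"
    unfolding transposition_sum_def young_sum_def perm_act_def sum_distrib_left
    by (subst (2) sum.swap, subst sum.swap) (rule refl)
  also have "\<dots> = young_sum b r c (transposition_sum r v) f"
    unfolding young_sum_def
    by (rule sum.cong[OF refl], subst transposition_sum_perm_act)
      (auto simp: perm_act_def dest: young_permutes)
  finally show "transposition_sum r (young_sum b r c v) f = young_sum b r c (transposition_sum r v) f" .
qed

text \<open>If moving one point to a block with a smaller index always annihilates \<open>u\<close>, then the
  transpositions between two fixed blocks act on \<open>young_sum b r c u\<close> by a scalar.\<close>

lemma transposition_sum_eigenvector:
  assumes lower: "\<And>x i. x \<in> {1..r} \<Longrightarrow> i < c x \<Longrightarrow> young_sum b r (c(x := i)) u = (\<lambda>_. 0)"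
  defines "s \<equiv> (if b then -1 else 1 :: real)"
  shows "transposition_sum r (young_sum b r c u) f =
    (real r + s * real (same_label_pairs r c) - 2 * s * real (\<Sum>x\<in>{1..r}. c x)) * young_sum b r c u f"
proof -
  define v where "v = young_sum b r c u"
  define A where "A = {1..r}"
  define h where "h x y = v (f \<circ> swap x y)" for x y
  have finA: "finite A" by (simp add: A_def)
  have h_sym: "h x y = h y x" for x y by (simp add: h_def transpose_commute)
  have v: "v (g \<circ> d) = perm_weight b d * v g" if "d \<in> young r c" for d g
    unfolding v_def using perm_act_young_sum[OF that] .
  \<comment> \<open>The Young sum for the changed labelling vanishes, and by
    \<open>young_sum_split\<close> it is a positive multiple of this Garnir-type relation.\<close>
  have block: "(\<Sum>y\<in>{y\<in>A. c y = i}. h x y) = - s * v f" if x: "x \<in> A" "i < c x" for x i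
  proof -
    have "0 = real (card {d \<in> young r c. d x = x}) * (v f + s * (\<Sum>y\<in>{y\<in>A. c y = i}. h x y))"
      using young_sum_split[of x r i c v b f] young_sum_lower_zero[OF lower, of x i] x v
      unfolding A_def s_def h_def v_def by simp
    moreover have "card {d \<in> young r c. d x = x} \<noteq> 0"
      using finite_young[of r c] id_in_young[of r c] by auto
    ultimately have "v f + s * (\<Sum>y\<in>{y\<in>A. c y = i}. h x y) = 0" by simp
    then show ?thesis by (auto simp: s_def split: if_splits)
  qed
  have lower_sum: "(\<Sum>y\<in>{y\<in>A. c y < c x}. h x y) = - s * real (c x) * v f" if x: "x \<in> A" for x
  proof -
    have "(\<Sum>y\<in>{y\<in>A. c y < c x}. h x y) = (\<Sum>i\<in>{..<c x}. \<Sum>y\<in>{y\<in>{y\<in>A. c y < c x}. c y = i}. h x y)"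
      by (rule sum.group[symmetric]) (use finA in auto)
    also have "\<dots> = (\<Sum>i\<in>{..<c x}. - s * v f)"
    proof (rule sum.cong[OF refl])
      fix i assume "i \<in> {..<c x}"
      then have "{y\<in>{y\<in>A. c y < c x}. c y = i} = {y\<in>A. c y = i}" and "i < c x" by auto
      then show "(\<Sum>y\<in>{y\<in>{y\<in>A. c y < c x}. c y = i}. h x y) = - s * v f" using block[OF x] by simp
    qed
    finally show ?thesis by simp
  qed
  have same: "h x y = s * v f" if "x \<in> A" "y \<in> A" "y \<noteq> x" "c y = c x" for x y
    using v[OF transpose_in_young[of x r y c]] that perm_weight_transpose[of x y b]
    unfolding h_def A_def s_def by simp
  have lt: "(\<Sum>x\<in>A. \<Sum>y\<in>{y\<in>A. c y < c x}. h x y) = - s * real (\<Sum>x\<in>A. c x) * v f"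
    using lower_sum by (simp add: sum_distrib_left sum_distrib_right)
  have gt: "(\<Sum>x\<in>A. \<Sum>y\<in>{y\<in>A. c x < c y}. h x y) = - s * real (\<Sum>x\<in>A. c x) * v f"
    unfolding lt[symmetric] using h_sym
    by (subst sum.swap_restrict[OF finA finA]) simp
  have eq: "(\<Sum>x\<in>A. \<Sum>y\<in>{y\<in>A. y \<noteq> x \<and> c y = c x}. h x y) = s * real (same_label_pairs r c) * v f"
  proof -
    have "(\<Sum>x\<in>A. \<Sum>y\<in>{y\<in>A. y \<noteq> x \<and> c y = c x}. h x y) =
        (\<Sum>x\<in>A. \<Sum>y\<in>{y\<in>A. y \<noteq> x \<and> c y = c x}. s * v f)"
      by (intro sum.cong refl) (use same in auto)
    then show ?thesis
      by (simp add: same_label_pairs_def A_def sum_distrib_left sum_distrib_right mult_ac)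
  qed
  have split: "(\<Sum>y\<in>A. h x y) = v f + (\<Sum>y\<in>{y\<in>A. y \<noteq> x \<and> c y = c x}. h x y)
      + (\<Sum>y\<in>{y\<in>A. c y < c x}. h x y) + (\<Sum>y\<in>{y\<in>A. c x < c y}. h x y)" if x: "x \<in> A" for x
  proof -
    have "A = {x} \<union> {y\<in>A. y \<noteq> x \<and> c y = c x} \<union> {y\<in>A. c y < c x} \<union> {y\<in>A. c x < c y}"
      using x by auto
    then have "(\<Sum>y\<in>A. h x y) =
        (\<Sum>y\<in>{x} \<union> {y\<in>A. y \<noteq> x \<and> c y = c x} \<union> {y\<in>A. c y < c x} \<union> {y\<in>A. c x < c y}. h x y)"
      by simp
    also have "\<dots> = h x x + (\<Sum>y\<in>{y\<in>A. y \<noteq> x \<and> c y = c x}. h x y)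
      + (\<Sum>y\<in>{y\<in>A. c y < c x}. h x y) + (\<Sum>y\<in>{y\<in>A. c x < c y}. h x y)"
      using finA by (subst sum.union_disjoint; (subst sum.union_disjoint)?; (subst sum.union_disjoint)?; auto)
    finally show ?thesis by (simp add: h_def)
  qed
  have "transposition_sum r v f = (\<Sum>x\<in>A. \<Sum>y\<in>A. h x y)"
    by (simp add: transposition_sum_def h_def A_def)
  also have "\<dots> = real r * v f + s * real (same_label_pairs r c) * v f
      + 2 * (- s * real (\<Sum>x\<in>A. c x) * v f)"
    by (simp add: split sum.distrib lt gt eq) (simp add: A_def)
  finally show ?thesis unfolding v_def A_def by (simp add: algebra_simps)
qed

section \<open>Labellings that form a Young diagram\<close>

lemma same_label_pairs_kernel_cong:
  assumes "\<And>x y. x \<in> {1..r} \<Longrightarrow> y \<in> {1..r} \<Longrightarrow> c x = c y \<longleftrightarrow> c' x = c' y"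
  shows "same_label_pairs r c = same_label_pairs r c'"
  unfolding same_label_pairs_def
  by (intro sum.cong refl arg_cong[of _ _ card] Collect_cong) (use assms in auto)

lemma card_filter_sum: "finite A \<Longrightarrow> card {y\<in>A. P y} = (\<Sum>y\<in>A. of_bool (P y))"
  by (simp add: of_bool_def sum.If_cases Int_def)

lemma same_label_pairs_bound: "same_label_pairs r c \<le> r * r"
proof -
  have "card {y\<in>{1..r}. y \<noteq> x \<and> c y = c x} \<le> r" for x
  proof -
    have "card {y\<in>{1..r}. y \<noteq> x \<and> c y = c x} \<le> card {1..r}" by (rule card_mono) auto
    then show ?thesis by simp
  qed
  then have "same_label_pairs r c \<le> (\<Sum>x\<in>{1..r}. r)"
    unfolding same_label_pairs_def by (intro sum_mono) auto
  then show ?thesis by simp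
qed

lemma same_label_pairs_remove:
  assumes x: "x \<in> {1..r}"
  shows "same_label_pairs r c =
    (\<Sum>a\<in>{1..r} - {x}. card {y\<in>{1..r} - {x}. y \<noteq> a \<and> c y = c a})
      + 2 * card {y\<in>{1..r} - {x}. c y = c x}"
proof -
  let ?A = "{1..r} - {x}"
  have "same_label_pairs r c = card {y\<in>{1..r}. y \<noteq> x \<and> c y = c x} +
      (\<Sum>a\<in>?A. card {y\<in>{1..r}. y \<noteq> a \<and> c y = c a})"
    unfolding same_label_pairs_def using x by (subst sum.remove[of _ x]) auto
  also have "{y\<in>{1..r}. y \<noteq> x \<and> c y = c x} = {y\<in>?A. c y = c x}" by auto
  also have "(\<Sum>a\<in>?A. card {y\<in>{1..r}. y \<noteq> a \<and> c y = c a}) =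
      (\<Sum>a\<in>?A. card {y\<in>?A. y \<noteq> a \<and> c y = c a} + of_bool (c a = c x))"
  proof (rule sum.cong[OF refl])
    fix a assume a: "a \<in> ?A"
    have "{y\<in>{1..r}. y \<noteq> a \<and> c y = c a} =
        (if c a = c x then insert x else id) {y\<in>?A. y \<noteq> a \<and> c y = c a}"
      using a x by auto
    then show "card {y\<in>{1..r}. y \<noteq> a \<and> c y = c a} =
        card {y\<in>?A. y \<noteq> a \<and> c y = c a} + of_bool (c a = c x)"
      by (simp add: card_insert_if)
  qed
  also have "\<dots> = (\<Sum>a\<in>?A. card {y\<in>?A. y \<noteq> a \<and> c y = c a}) + card {y\<in>?A. c y = c x}"
    unfolding sum.distrib by (subst (2) card_filter_sum) auto
  finally show ?thesis by simp
qed

text \<open>The point loses the partners in its old class, which are one fewer than that class has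
  elements, and gains the whole class \<open>i\<close>.\<close>

lemma same_label_pairs_move:
  assumes x: "x \<in> {1..r}" and i: "i \<noteq> c x"
    and le: "card {y\<in>{1..r}. c y = c x} \<le> card {y\<in>{1..r}. c y = i}"
  shows "same_label_pairs r c < same_label_pairs r (c(x := i))"
proof -
  let ?A = "{1..r} - {x}"
  let ?c = "c(x := i)"
  have 1: "(\<Sum>a\<in>?A. card {y\<in>?A. y \<noteq> a \<and> ?c y = ?c a}) = (\<Sum>a\<in>?A. card {y\<in>?A. y \<noteq> a \<and> c y = c a})"
    by (intro sum.cong refl arg_cong[of _ _ card]) auto
  have 2: "{y\<in>?A. ?c y = ?c x} = {y\<in>{1..r}. c y = i}" using i by auto
  have "{y\<in>{1..r}. c y = c x} = insert x {y\<in>?A. c y = c x}" using x by auto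
  then have 3: "card {y\<in>{1..r}. c y = c x} = Suc (card {y\<in>?A. c y = c x})" by simp
  show ?thesis
    unfolding same_label_pairs_remove[OF x, of c] same_label_pairs_remove[OF x, of ?c] 1 2
    using le 3 by simp
qed

text \<open>Numbering classes by decreasing size turns "smaller index" into "at least as large", the
  form in which moves of single points are estimated.\<close>

lemma sort_labels:
  fixes s :: "'a \<Rightarrow> nat"
  assumes "finite A"
  shows "\<exists>g. inj_on g A \<and> g ` A = {..<card A} \<and> (\<forall>a\<in>A. \<forall>b\<in>A. g a \<le> g b \<longrightarrow> s b \<le> s a)"
  using assms
\<comment> \<open>With the negated size as rank, the inserted element has the least size so far and
  can take the last number.\<close>
proof (induction A rule: finite_ranking_induct[where f = "\<lambda>a. - int (s a)"])
  case empty
  then show ?case by simp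
next
  case (insert x S)
  show ?case
  proof (cases "x \<in> S")
    case True
    then show ?thesis using insert.IH by (simp add: insert_absorb)
  next
    case x: False
    obtain g where g: "inj_on g S" "g ` S = {..<card S}" "\<forall>a\<in>S. \<forall>b\<in>S. g a \<le> g b \<longrightarrow> s b \<le> s a"
      using insert.IH by blast
    have gS: "g a < card S" if "a \<in> S" for a using g(2) that by blast
    let ?g = "g(x := card S)"
    have gimg: "?g ` S = {..<card S}" using x g(2) by (metis (no_types, lifting) fun_upd_other image_cong)
    have "inj_on ?g S" using g(1) x by (subst inj_on_cong[of _ _ g]) auto
    then have "inj_on ?g (insert x S)" using x gimg by (simp add: inj_on_insert)
    moreover have "?g ` insert x S = {..<card (insert x S)}"
      using x insert.hyps(1) gimg by (simp add: lessThan_Suc)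
    moreover have "\<forall>a\<in>insert x S. \<forall>b\<in>insert x S. ?g a \<le> ?g b \<longrightarrow> s b \<le> s a"
    proof (intro ballI impI)
      fix a b assume ab: "a \<in> insert x S" "b \<in> insert x S" "?g a \<le> ?g b"
      consider "a = b" | "b = x" "a \<in> S" | "a = x" "b \<in> S" "b \<noteq> x" | "a \<in> S" "b \<in> S" "a \<noteq> x" "b \<noteq> x"
        using ab by auto
      then show "s b \<le> s a"
      proof cases
        case 2
        then show ?thesis using insert.hyps(2)[of a] by simp
      next
        case 3
        then show ?thesis using ab(3) gS[of b] by simp
      next
        case 4
        then show ?thesis using ab(3) g(3) by simp
      qed simp
    qed
    ultimately show ?thesis by blast
  qed
qed

lemma downset_eq_lessThan:
  fixes S :: "nat set"
  assumes "finite S" "\<And>i k. i \<in> S \<Longrightarrow> k < i \<Longrightarrow> k \<in> S"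
  shows "S = {..<card S}"
proof (rule card_subset_eq)
  show "S \<subseteq> {..<card S}"
  proof
    fix i assume i: "i \<in> S"
    then have "{..i} \<subseteq> S" using assms(2) by (auto simp: le_less)
    then have "card {..i} \<le> card S" using assms(1) card_mono by blast
    then show "i \<in> {..<card S}" by simp
  qed
qed auto

lemma card_pairs_symmetric:
  fixes g :: "nat \<Rightarrow> nat"
  assumes A: "finite A"
  shows "(\<Sum>x\<in>A. card {y\<in>A. c y = c x \<and> g x < g y}) = (\<Sum>x\<in>A. card {y\<in>A. c y = c x \<and> g y < g x})"
  unfolding card_filter_sum[OF A]
  by (subst sum.swap, intro sum.cong refl arg_cong[of _ _ of_bool]) auto

text \<open>Inside a class of \<open>c\<close> the second label is injective, so it orients every
  pair, and both orientations occur equally often.\<close>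

lemma same_label_pairs_split:
  assumes inj: "inj_on (\<lambda>x. (c x, g x)) {1..r}"
  shows "same_label_pairs r c = 2 * (\<Sum>x\<in>{1..r}. card {y\<in>{1..r}. c y = c x \<and> g y < (g x :: nat)})"
proof -
  have "card {y\<in>{1..r}. y \<noteq> x \<and> c y = c x} =
      card {y\<in>{1..r}. c y = c x \<and> g y < g x} + card {y\<in>{1..r}. c y = c x \<and> g x < g y}"
    if x: "x \<in> {1..r}" for x
  proof -
    have "{y\<in>{1..r}. y \<noteq> x \<and> c y = c x} =
        {y\<in>{1..r}. c y = c x \<and> g y < g x} \<union> {y\<in>{1..r}. c y = c x \<and> g x < g y}"
      (is "_ = ?L \<union> ?R")
    proof -
      have "g y \<noteq> g x" if "y \<in> {1..r}" "y \<noteq> x" "c y = c x" for y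
        using inj_onD[OF inj, of y x] that x by auto
      then have "g y < g x \<or> g x < g y" if "y \<in> {1..r}" "y \<noteq> x" "c y = c x" for y
        using that by (meson linorder_neqE_nat)
      then show ?thesis by auto
    qed
    moreover have "card (?L \<union> ?R) = card ?L + card ?R" by (rule card_Un_disjoint) auto
    ultimately show ?thesis by simp
  qed
  then have "same_label_pairs r c = (\<Sum>x\<in>{1..r}.
      card {y\<in>{1..r}. c y = c x \<and> g y < g x} + card {y\<in>{1..r}. c y = c x \<and> g x < g y})"
    unfolding same_label_pairs_def by (rule sum.cong[OF refl])
  then show ?thesis
    by (simp only: sum.distrib card_pairs_symmetric[OF finite_atLeastAtMost] mult_2)
qed

text \<open>In a Young diagram every cell has as many cells to its left, and as many above it, as its
  coordinates say; in any other arrangement of cells there are fewer.\<close>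

lemma labels_downward_closed:
  fixes c g :: "nat \<Rightarrow> nat"
  assumes inj: "inj_on (\<lambda>x. (c x, g x)) {1..r}"
    and eq: "same_label_pairs r c + same_label_pairs r g = 2 * (\<Sum>x\<in>{1..r}. c x) + 2 * (\<Sum>x\<in>{1..r}. g x)"
    and x: "x \<in> {1..r}" and i: "i < c x"
  shows "\<exists>y\<in>{1..r}. g y = g x \<and> c y = i"
proof -
  define P where "P x = {y\<in>{1..r}. c y = c x \<and> g y < g x}" for x
  define Q where "Q x = {y\<in>{1..r}. g y = g x \<and> c y < c x}" for x
  have inj': "inj_on (\<lambda>x. (g x, c x)) {1..r}"
    by (rule inj_onI, rule inj_onD[OF inj]) simp_all
  have Pinj: "inj_on g (P x)" for x
    by (rule inj_onI, rule inj_onD[OF inj]) (simp_all add: P_def)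
  have Psub: "g ` P x \<subseteq> {..<g x}" for x by (auto simp: P_def)
  have P: "card (P x) \<le> g x" for x
    using card_inj_on_le[OF Pinj Psub] by simp
  have Qinj: "inj_on c (Q x)" for x
    by (rule inj_onI, rule inj_onD[OF inj]) (simp_all add: Q_def)
  have Qsub: "c ` Q x \<subseteq> {..<c x}" for x by (auto simp: Q_def)
  have Q: "card (Q x) \<le> c x" for x
    using card_inj_on_le[OF Qinj Qsub] by simp
  \<comment> \<open>After halving, \<open>eq\<close> says that the bounds on \<open>P\<close> and
    \<open>Q\<close> are attained in total, hence at every single point.\<close>
  have "(\<Sum>x\<in>{1..r}. card (P x) + card (Q x)) = (\<Sum>x\<in>{1..r}. g x + c x)"
    using eq unfolding same_label_pairs_split[OF inj] same_label_pairs_split[OF inj'] P_def Q_def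
    by (simp add: sum.distrib)
  then have "card (P x) + card (Q x) = g x + c x"
    by (rule sum_mono_inv[OF _ add_mono[OF P Q] x]) simp
  then have "card (Q x) = c x" using P[of x] Q[of x] by simp
  then have "c ` Q x = {..<c x}"
    using card_image[OF Qinj, of x] by (intro card_subset_eq[OF _ Qsub]) auto
  then have "i \<in> c ` Q x" using i by simp
  then show ?thesis by (auto simp: Q_def)
qed

section \<open>Tableaux from labellings\<close>

definition column_of :: "nat list \<Rightarrow> (nat \<times> nat \<Rightarrow> nat) \<Rightarrow> nat \<Rightarrow> nat" where
  "column_of lam T x = snd (the_inv_into (cells lam) T x)"

text \<open>The rows reaching beyond column \<open>j\<close> form an initial segment because the
  parts decrease, so their number determines which they are.\<close>

lemma less_conj_part_iff:
  assumes "is_partition lam"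
  shows "i < conj_part lam (Suc j) \<longleftrightarrow> i < length lam \<and> j < lam ! i"
proof -
  let ?S = "{k. k < length lam \<and> Suc j \<le> lam ! k}"
  have "?S = {..<card ?S}"
  proof (rule downset_eq_lessThan)
    fix i k assume ik: "i \<in> ?S" "k < i"
    then have "lam ! i \<le> lam ! k"
      using assms sorted_wrt_nth_less[of "(\<ge>)" lam k i] by (auto simp: is_partition_def)
    then show "k \<in> ?S" using ik by auto
  qed auto
  then show ?thesis unfolding conj_part_def by (metis (mono_tags, lifting) Suc_le_eq lessThan_iff mem_Collect_eq)
qed

lemma cells_conj_part:
  "is_partition lam \<Longrightarrow> cells lam = {(i, j). i < conj_part lam (Suc j)}"
  by (simp add: cells_def less_conj_part_iff)

text \<open>By \<open>down\<close> every column is filled from the top, and \<open>size\<close>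
  prescribes its length; hence the pair of labels is a bijection onto the cells, and its inverse is
  the tableau.\<close>

lemma exists_tableau:
  assumes lam: "partition_of r lam"
    and size: "\<And>j. card {x\<in>{1..r}. g x = j} = conj_part lam (Suc j)"
    and inj: "inj_on (\<lambda>x. (c x, g x)) {1..r}"
    and down: "\<And>x i. x \<in> {1..r} \<Longrightarrow> i < c x \<Longrightarrow> \<exists>y\<in>{1..r}. g y = g x \<and> c y = i"
  shows "\<exists>T\<in>tableaux lam. \<forall>x\<in>{1..r}. tabloid_of lam T x = c x \<and> column_of lam T x = g x"
proof -
  let ?h = "\<lambda>x. (c x, g x)"
  have col: "{i. (i, j) \<in> ?h ` {1..r}} = {..<conj_part lam (Suc j)}" for j
  proof -
    let ?S = "{i. (i, j) \<in> ?h ` {1..r}}"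
    have S: "?S = c ` {x\<in>{1..r}. g x = j}" by auto
    have "?S = {..<card ?S}"
    proof (rule downset_eq_lessThan)
      show "finite ?S" unfolding S by simp
      show "k \<in> ?S" if "i \<in> ?S" "k < i" for i k using that down by force
    qed
    moreover have "card ?S = conj_part lam (Suc j)"
      unfolding S size[symmetric]
      by (intro card_image inj_onI, rule inj_onD[OF inj]) simp_all
    ultimately show ?thesis by simp
  qed
  have "?h ` {1..r} = cells lam"
    using col lam by (auto simp: cells_conj_part partition_of_def set_eq_iff)
  then have bij: "bij_betw ?h {1..r} (cells lam)" using inj by (simp add: bij_betw_def)
  define T where "T = the_inv_into {1..r} ?h"
  have T: "bij_betw T (cells lam) {1..r}" unfolding T_def using bij by (rule bij_betw_the_inv_into)
  have inv: "the_inv_into (cells lam) T x = ?h x" if "x \<in> {1..r}" for x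
  proof (rule the_inv_into_f_eq)
    show "inj_on T (cells lam)" using T by (rule bij_betw_imp_inj_on)
    show "T (?h x) = x" unfolding T_def using inj that by (rule the_inv_into_f_f)
    show "?h x \<in> cells lam" using bij that by (auto simp: bij_betw_def)
  qed
  have "T \<in> tableaux lam" using T lam by (simp add: tableaux_def partition_of_def)
  then show ?thesis using inv lam
    by (auto intro!: bexI[of _ T] simp: tabloid_of_def column_of_def partition_of_def)
qed

text \<open>Among all row labellings whose symmetrizer does not annihilate \<open>w\<close> take one with
  the most pairs of points in a common row. The sum of all transpositions acts by scalars both on
  \<open>w\<close> and on its symmetrization, and comparing them forces the rows and columns to form a Young
  diagram.\<close>

proposition exists_tableau_sums_nonzero:
  assumes lam: "partition_of r lam"
    and size: "\<And>j. card {x\<in>{1..r}. g x = j} = conj_part lam (Suc j)"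
    and nz: "young_sum True r g u \<noteq> (\<lambda>_. 0)"
    and lower: "\<And>x j. x \<in> {1..r} \<Longrightarrow> j < g x \<Longrightarrow> young_sum True r (g(x := j)) u = (\<lambda>_. 0)"
  shows "\<exists>T\<in>tableaux lam.
    young_sum False r (tabloid_of lam T) (young_sum True r (column_of lam T) u) \<noteq> (\<lambda>_. 0)"
proof -
  define w where "w = young_sum True r g u"
  let ?P = "\<lambda>c. young_sum False r c w \<noteq> (\<lambda>_. 0)"
  \<comment> \<open>With all labels distinct the symmetrizer is the identity, so at least one
    labelling satisfies \<open>?P\<close>.\<close>
  have "p = id" if p: "p \<in> young r id" for p
  proof
    fix x
    show "p x = id x"
    proof (cases "x \<in> {1..r}")
      case True
      then show ?thesis using p by (simp add: young_def)
    next
      case False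
      then show ?thesis using permutes_not_in[OF young_permutes[OF p]] by simp
    qed
  qed
  then have "young r id = {id}" using id_in_young[of r id] by blast
  then have "young_sum False r id w = w" by (simp add: young_sum_def)
  then have "?P id" using nz by (simp add: w_def)
  then have "\<exists>c0. ?P c0 \<and> (\<forall>c. ?P c \<longrightarrow> same_label_pairs r c \<le> same_label_pairs r c0)"
    by (rule ex_has_greatest_nat[of ?P _ _ "Suc (r * r)"]) (simp add: same_label_pairs_bound less_Suc_eq_le)
  then obtain c0 where c0: "?P c0" "\<And>c. ?P c \<Longrightarrow> same_label_pairs r c \<le> same_label_pairs r c0"
    by blast
  \<comment> \<open>The eigenvector lemma needs a numbering of the rows. Renumbering by decreasing
    size changes neither the Young subgroup nor the number of pairs.\<close>
  obtain \<sigma> where \<sigma>: "inj_on \<sigma> (c0 ` {1..r})" "\<sigma> ` c0 ` {1..r} = {..<card (c0 ` {1..r})}"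
    "\<And>a b. a \<in> c0 ` {1..r} \<Longrightarrow> b \<in> c0 ` {1..r} \<Longrightarrow> \<sigma> a \<le> \<sigma> b \<Longrightarrow>
      card {y\<in>{1..r}. c0 y = b} \<le> card {y\<in>{1..r}. c0 y = a}"
    using sort_labels[of "c0 ` {1..r}" "\<lambda>i. card {y\<in>{1..r}. c0 y = i}"] by auto
  define c where "c = \<sigma> \<circ> c0"
  have ker: "c0 x = c0 y \<longleftrightarrow> c x = c y" if "x \<in> {1..r}" "y \<in> {1..r}" for x y
    using \<sigma>(1) that by (auto simp: c_def inj_on_eq_iff)
  have cP: "?P c" using c0(1) young_kernel_cong[of r c0 c] ker by (simp add: young_sum_def)
  have cmax: "same_label_pairs r c' \<le> same_label_pairs r c" if "?P c'" for c'
    using c0(2)[OF that] same_label_pairs_kernel_cong[of r c0 c] ker by simp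
  \<comment> \<open>The label \<open>i\<close> occurs because the labels fill an initial segment,
    and row \<open>i\<close> is at least as large as the row of \<open>x\<close>; the move would
    increase the number of pairs, against maximality.\<close>
  have row_lower: "young_sum False r (c(x := i)) w = (\<lambda>_. 0)" if x: "x \<in> {1..r}" and i: "i < c x" for x i
  proof (rule ccontr)
    assume "young_sum False r (c(x := i)) w \<noteq> (\<lambda>_. 0)"
    then have le: "same_label_pairs r (c(x := i)) \<le> same_label_pairs r c" by (rule cmax)
    have "c x < card (c0 ` {1..r})" using \<sigma>(2) x by (force simp: c_def)
    then have "i \<in> \<sigma> ` c0 ` {1..r}" using i \<sigma>(2) by simp
    then obtain z where z: "z \<in> {1..r}" "c z = i" by (auto simp: c_def)
    have sz: "{y\<in>{1..r}. c0 y = c0 z'} = {y\<in>{1..r}. c y = c z'}" if "z' \<in> {1..r}" for z'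
      using ker that by auto
    have "card {y\<in>{1..r}. c y = c x} \<le> card {y\<in>{1..r}. c y = i}"
      using \<sigma>(3)[of "c0 z" "c0 x"] x z i sz[OF x] sz[OF z(1)] by (simp add: c_def)
    then show False using same_label_pairs_move[of x r i c] x i le by simp
  qed
  \<comment> \<open>A transposition inside both a row and a column is absorbed by the row sum with
    weight 1 but negates \<open>w\<close>.\<close>
  have inj: "inj_on (\<lambda>x. (c x, g x)) {1..r}"
  proof (rule inj_onI, rule ccontr)
    fix x y assume xy: "x \<in> {1..r}" "y \<in> {1..r}" "(c x, g x) = (c y, g y)" "x \<noteq> y"
    have tc: "swap x y \<in> young r c" and tg: "swap x y \<in> young r g"
      using transpose_in_young xy by auto
    have "perm_act (swap x y) w = (\<lambda>f. - w f)"
      using perm_act_young_sum[OF tg, of True u] xy(4)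
      by (simp add: w_def perm_act_def perm_weight_transpose)
    moreover have "young_sum False r c (perm_act (swap x y) w) f = young_sum False r c w f" for f
      using young_sum_perm_act_absorb[OF tc, of False w f] by (simp add: perm_weight_def)
    moreover have "young_sum False r c (\<lambda>f. - w f) f = - young_sum False r c w f" for f
      by (simp add: young_sum_def sum_negf)
    ultimately have "young_sum False r c w f = - young_sum False r c w f" for f by metis
    then have "young_sum False r c w = (\<lambda>_. 0)" by auto
    then show False using cP by simp
  qed
  have "real (same_label_pairs r c + same_label_pairs r g) = real (2 * (\<Sum>x\<in>{1..r}. c x) + 2 * (\<Sum>x\<in>{1..r}. g x))"
  proof -
    obtain f where f: "young_sum False r c w f \<noteq> 0" using cP by auto
    \<comment> \<open>The eigenvalue of \<open>w\<close>. The transposition sum commutes with Young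
      sums, so it is also the eigenvalue after row symmetrization.\<close>
    define k where "k = real r - real (same_label_pairs r g) + 2 * real (\<Sum>x\<in>{1..r}. g x)"
    have "transposition_sum r w = (\<lambda>f. k * w f)"
      using transposition_sum_eigenvector[where b = True, OF lower] by (simp add: w_def k_def fun_eq_iff)
    then have "transposition_sum r (young_sum False r c w) f = k * young_sum False r c w f"
      unfolding transposition_sum_young_sum
      by (simp add: young_sum_def sum_distrib_left mult_ac)
    moreover have "transposition_sum r (young_sum False r c w) f =
        (real r + real (same_label_pairs r c) - 2 * real (\<Sum>x\<in>{1..r}. c x)) * young_sum False r c w f"
      using transposition_sum_eigenvector[where b = False, OF row_lower] by simp
    ultimately have "k = real r + real (same_label_pairs r c) - 2 * real (\<Sum>x\<in>{1..r}. c x)"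
      using f by simp
    then show ?thesis unfolding k_def by simp
  qed
  then have "same_label_pairs r c + same_label_pairs r g = 2 * (\<Sum>x\<in>{1..r}. c x) + 2 * (\<Sum>x\<in>{1..r}. g x)"
    by (simp only: of_nat_eq_iff)
  note down = labels_downward_closed[OF inj this]
  obtain T where T: "T \<in> tableaux lam"
      "\<forall>x\<in>{1..r}. tabloid_of lam T x = c x \<and> column_of lam T x = g x"
    using exists_tableau[OF lam size inj down] by blast
  have "young_sum False r (tabloid_of lam T) = young_sum False r c"
    "young_sum True r (column_of lam T) = young_sum True r g"
    using T(2) by (auto intro: young_sum_cong)
  then show ?thesis using T(1) cP by (intro bexI[of _ T]) (simp_all add: w_def)
qed

section \<open>Traces\<close>

interpretation mv: vector_space mscale
  by unfold_locales (auto simp: mscale_def fun_eq_iff algebra_simps)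

lemma sum_mvec_apply: "(\<Sum>a\<in>A. F a) f = (\<Sum>a\<in>A. (F a :: mvec) f)"
  by (induction A rule: infinite_finite_induct) auto

text \<open>\<open>irr_char\<close> is computed in an arbitrarily chosen basis; this permits one
  adapted to the invariants. Both sides equal one double sum over coordinates, as in the proof that
  two matrices have the same trace of their product in either order.\<close>

lemma trace_basis_independent:
  assumes B: "finite B" "\<not> mv.dependent B" and C: "finite C" "\<not> mv.dependent C"
    and span: "mv.span B = mv.span C"
    and lin: "Vector_Spaces.linear mscale mscale h"
    and closed: "\<And>v. v \<in> mv.span B \<Longrightarrow> h v \<in> mv.span B"
  shows "(\<Sum>b\<in>B. mv.representation B (h b) b) = (\<Sum>c\<in>C. mv.representation C (h c) c)"
proof -
  interpret h: Vector_Spaces.linear mscale mscale h by (rule lin)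
  have hB: "h b \<in> mv.span C" if "b \<in> B" for b using closed[OF mv.span_base[OF that]] span by simp
  have CB: "c \<in> mv.span B" if "c \<in> C" for c using mv.span_base[OF that] span by simp
  have 1: "mv.representation B (h b) b = (\<Sum>c\<in>C. mv.representation C (h b) c * mv.representation B c b)"
    if b: "b \<in> B" for b
  proof -
    have "mv.representation B (h b) b =
        mv.representation B (\<Sum>c\<in>C. mscale (mv.representation C (h b) c) c) b"
      using mv.sum_representation_eq[OF C(2) hB[OF b] C(1) subset_refl] by simp
    also have "\<dots> = (\<Sum>c\<in>C. mv.representation C (h b) c * mv.representation B c b)"
      by (subst mv.representation_sum[OF B(2)])
        (auto simp: CB mv.span_scale mv.representation_scale[OF B(2)] intro!: sum.cong)
    finally show ?thesis .
  qed
  have 2: "mv.representation C (h c) c = (\<Sum>b\<in>B. mv.representation C (h b) c * mv.representation B c b)"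
    if c: "c \<in> C" for c
  proof -
    have "h c = h (\<Sum>b\<in>B. mscale (mv.representation B c b) b)"
      using mv.sum_representation_eq[OF B(2) CB[OF c] B(1) subset_refl] by simp
    also have "\<dots> = (\<Sum>b\<in>B. mscale (mv.representation B c b) (h b))"
      by (simp add: h.sum h.scale)
    finally have "mv.representation C (h c) c =
        mv.representation C (\<Sum>b\<in>B. mscale (mv.representation B c b) (h b)) c" by simp
    also have "\<dots> = (\<Sum>b\<in>B. mv.representation C (h b) c * mv.representation B c b)"
      by (subst mv.representation_sum[OF C(2)])
        (auto simp: hB mv.span_scale mv.representation_scale[OF C(2)] intro!: sum.cong)
    finally show ?thesis .
  qed
  have "(\<Sum>b\<in>B. mv.representation B (h b) b) =
      (\<Sum>b\<in>B. \<Sum>c\<in>C. mv.representation C (h b) c * mv.representation B c b)"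
    by (simp add: 1)
  also have "\<dots> = (\<Sum>c\<in>C. mv.representation C (h c) c)"
    by (subst sum.swap) (simp add: 2)
  finally show ?thesis .
qed

text \<open>In a basis extending a basis \<open>C1\<close> of \<open>W\<close> the diagonal entries
  are 1 on \<open>C1\<close> and 0 elsewhere. That the trace is a natural number later turns nonzero
  multiplicities into multiplicities at least 1.\<close>

lemma trace_projection:
  assumes B: "finite B" "\<not> mv.dependent B"
    and lin: "Vector_Spaces.linear mscale mscale h"
    and W: "W \<subseteq> mv.span B"
    and into: "\<And>v. v \<in> mv.span B \<Longrightarrow> h v \<in> W"
    and idem: "\<And>v. v \<in> W \<Longrightarrow> h v = v"
  shows "\<exists>d::nat. (\<Sum>b\<in>B. mv.representation B (h b) b) = real d \<and> (d = 0 \<longleftrightarrow> W \<subseteq> {0})"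
proof -
  obtain C1 where C1: "C1 \<subseteq> W" "\<not> mv.dependent C1" "W \<subseteq> mv.span C1"
    using mv.maximal_independent_subset[of W] by metis
  have "C1 \<subseteq> mv.span B" using C1(1) W by simp
  then obtain C where C: "C1 \<subseteq> C" "C \<subseteq> mv.span B" "\<not> mv.dependent C" "mv.span B \<subseteq> mv.span C"
    using mv.maximal_independent_subset_extend[OF _ C1(2)] by metis
  have finC: "finite C" using mv.independent_span_bound[OF B(1) C(3,2)] by simp
  have span: "mv.span B = mv.span C"
    using C(2,4) mv.span_minimal[OF C(2) mv.subspace_span] by blast
  have diag: "mv.representation C (h c) c = (if c \<in> C1 then 1 else 0)" if c: "c \<in> C" for c
  proof (cases "c \<in> C1")
    case True
    then have "h c = c" using idem C1(1) by auto
    then show ?thesis using True mv.representation_basis[OF C(3) c] by simp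
  next
    case False
    have hc: "h c \<in> mv.span C1" using into C(2) c C1(3) by auto
    have "mv.representation C (h c) = mv.representation C1 (h c)"
      by (rule mv.representation_extend[OF C(3) hc C(1)])
    then show ?thesis using False mv.representation_ne_zero[of C1 "h c" c] by auto
  qed
  have "(\<Sum>b\<in>B. mv.representation B (h b) b) = (\<Sum>c\<in>C. mv.representation C (h c) c)"
    by (rule trace_basis_independent[OF B finC C(3) span lin]) (use into W in blast)
  also have "\<dots> = (\<Sum>c\<in>C. if c \<in> C1 then 1 else 0)" by (rule sum.cong[OF refl]) (rule diag)
  also have "\<dots> = real (card C1)"
    using C(1) finC by (simp add: sum.If_cases Int_absorb1)
  finally have tr: "(\<Sum>b\<in>B. mv.representation B (h b) b) = real (card C1)" .
  have "finite C1" using finC C(1) finite_subset by blast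
  moreover have "C1 = {} \<longleftrightarrow> W \<subseteq> {0}"
  proof
    assume "C1 = {}"
    then show "W \<subseteq> {0}" using C1(3) by simp
  next
    assume "W \<subseteq> {0}"
    then have "C1 \<subseteq> {0}" using C1(1) by blast
    moreover have "0 \<notin> C1" using C1(2) mv.dependent_zero by blast
    ultimately show "C1 = {}" by blast
  qed
  ultimately show ?thesis using tr by (intro exI[of _ "card C1"]) simp
qed

lemma linear_perm_act: "Vector_Spaces.linear mscale mscale (perm_act s)"
  by unfold_locales (auto simp: mscale_def perm_act_def fun_eq_iff algebra_simps)

section \<open>Polytabloids\<close>

lemma tableau_bij:
  assumes "partition_of r lam" "T \<in> tableaux lam"
  shows "bij_betw T (cells lam) {1..r}"
  using assms by (simp add: tableaux_def partition_of_def)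

lemma the_inv_into_perm_comp:
  assumes T: "bij_betw T (cells lam) {1..r}" and s: "s permutes {1..r}" and x: "x \<in> {1..r}"
  shows "the_inv_into (cells lam) (s \<circ> T) x = the_inv_into (cells lam) T (inv s x)"
proof -
  have bij: "bij_betw (s \<circ> T) (cells lam) {1..r}"
    using bij_betw_trans[OF T permutes_imp_bij[OF s]] .
  have "inv s x \<in> {1..r}" using permutes_mem[OF permutes_inv[OF s] x] .
  then have "inv s x \<in> T ` cells lam" using bij_betw_imp_surj_on[OF T] by blast
  then obtain c where c: "c \<in> cells lam" "T c = inv s x" by force
  then have "(s \<circ> T) c = x" using permutes_inverses(1)[OF s] by simp
  then show ?thesis
    using the_inv_into_f_f[OF bij_betw_imp_inj_on[OF bij] c(1)]
      the_inv_into_f_f[OF bij_betw_imp_inj_on[OF T] c(1)] c(2) by simp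
qed

lemma tabloid_of_perm_comp:
  assumes lam: "partition_of r lam" and T: "T \<in> tableaux lam" and s: "s permutes {1..r}"
  shows "tabloid_of lam (s \<circ> T) = tabloid_of lam T \<circ> inv s"
proof
  fix x
  have "inv s x \<in> {1..r} \<longleftrightarrow> x \<in> {1..r}" using permutes_in_image[OF permutes_inv[OF s]] .
  then show "tabloid_of lam (s \<circ> T) x = (tabloid_of lam T \<circ> inv s) x"
    using the_inv_into_perm_comp[OF tableau_bij[OF lam T] s] lam
    unfolding tabloid_of_def partition_of_def by auto
qed

lemma col_group_eq_young:
  assumes lam: "partition_of r lam" and T: "T \<in> tableaux lam"
  shows "col_group lam T = young r (column_of lam T)"
proof -
  have bij: "bij_betw T (cells lam) {1..r}" using tableau_bij[OF lam T] .
  have im: "T ` cells lam = {1..r}" using bij by (simp add: bij_betw_def)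
  have "column_of lam T (T c) = snd c" if "c \<in> cells lam" for c
    using the_inv_into_f_f[OF bij_betw_imp_inj_on[OF bij] that] by (simp add: column_of_def)
  then have "(\<forall>c\<in>cells lam. column_of lam T (p (T c)) = snd c) \<longleftrightarrow>
      (\<forall>x\<in>{1..r}. column_of lam T (p x) = column_of lam T x)" for p
    unfolding im[symmetric] by auto
  then show ?thesis using lam
    by (simp add: col_group_def young_def partition_of_def column_of_def)
qed

text \<open>The tabloid of \<open>p \<circ> T\<close> is that of \<open>T\<close> composed with
  \<open>inv p\<close>; moving \<open>p\<close> to the other side exhibits the column
  antisymmetrizer acting on an indicator function.\<close>

lemma polytabloid_eq_young_sum:
  assumes lam: "partition_of r lam" and T: "T \<in> tableaux lam"
  shows "polytabloid lam T =
    young_sum True r (column_of lam T) (\<lambda>f. of_bool (f = tabloid_of lam T))"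
proof
  fix f
  have "tabloid_of lam (p \<circ> T) = f \<longleftrightarrow> f \<circ> p = tabloid_of lam T"
    if "p \<in> young r (column_of lam T)" for p
  proof -
    have p: "p permutes {1..r}" using that by (rule young_permutes)
    show ?thesis unfolding tabloid_of_perm_comp[OF lam T p]
      using comp_inv_cancel(1,2)[OF p] by metis
  qed
  then show "polytabloid lam T f =
      young_sum True r (column_of lam T) (\<lambda>f. of_bool (f = tabloid_of lam T)) f"
    unfolding polytabloid_def col_group_eq_young[OF lam T] young_sum_def perm_weight_def
    by (intro sum.cong) auto
qed

lemma tableau_perm_comp:
  assumes lam: "partition_of r lam" and T: "T \<in> tableaux lam" and s: "s permutes {1..r}"
  shows "s \<circ> T \<in> tableaux lam"
  using bij_betw_trans[OF tableau_bij[OF lam T] permutes_imp_bij[OF s]] lam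
  by (simp add: tableaux_def partition_of_def)

lemma perm_act_polytabloid:
  assumes lam: "partition_of r lam" and T: "T \<in> tableaux lam" and s: "s permutes {1..r}"
  shows "perm_act s (polytabloid lam T) = polytabloid lam (s \<circ> T)"
proof -
  have col: "young_sum True r (column_of lam (s \<circ> T) \<circ> s) = young_sum True r (column_of lam T)"
  proof (rule young_sum_cong)
    fix x assume "x \<in> {1..r}"
    then have "s x \<in> {1..r}" by (rule permutes_mem[OF s])
    then show "(column_of lam (s \<circ> T) \<circ> s) x = column_of lam T x"
      using the_inv_into_perm_comp[OF tableau_bij[OF lam T] s] permutes_inverses(2)[OF s]
      by (simp add: column_of_def)
  qed
  have row: "perm_act s (\<lambda>f. of_bool (f = tabloid_of lam T)) = (\<lambda>f. of_bool (f = tabloid_of lam (s \<circ> T)))"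
  proof
    fix f
    have "f \<circ> s = tabloid_of lam T \<longleftrightarrow> f = tabloid_of lam (s \<circ> T)"
      unfolding tabloid_of_perm_comp[OF lam T s] using comp_inv_cancel(1,2)[OF s] by metis
    then show "perm_act s (\<lambda>f. of_bool (f = tabloid_of lam T)) f =
        of_bool (f = tabloid_of lam (s \<circ> T))" by (simp add: perm_act_def)
  qed
  show ?thesis
    unfolding polytabloid_eq_young_sum[OF lam T]
      polytabloid_eq_young_sum[OF lam tableau_perm_comp[OF lam T s]]
      row[symmetric] young_sum_perm_act[OF s] col ..
qed

lemma perm_act_specht:
  assumes lam: "partition_of r lam" and s: "s permutes {1..r}" and v: "v \<in> specht lam"
  shows "perm_act s v \<in> specht lam"
proof -
  interpret s: Vector_Spaces.linear mscale mscale "perm_act s" by (rule linear_perm_act)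
  have "perm_act s ` specht lam = mv.span (perm_act s ` polytabloid lam ` tableaux lam)"
    unfolding specht_def by (rule s.span_image[symmetric])
  also have "\<dots> \<subseteq> specht lam"
    unfolding specht_def
    by (intro mv.span_mono) (auto simp: perm_act_polytabloid[OF lam _ s] intro: tableau_perm_comp[OF lam _ s])
  finally show ?thesis using v by blast
qed

text \<open>A tableau is unconstrained outside the cells, so there can be infinitely many of them;
  their polytabloids, however, are translates of a single one under a finite group.\<close>

lemma finite_polytabloids:
  assumes lam: "partition_of r lam"
  shows "finite (polytabloid lam ` tableaux lam)"
proof (cases "tableaux lam = {}")
  case False
  then obtain T0 where T0: "T0 \<in> tableaux lam" by blast
  let ?S = "{s. s permutes {1..r}}"
  have b0: "bij_betw T0 (cells lam) {1..r}" using tableau_bij[OF lam T0] .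
  have "polytabloid lam T \<in> (\<lambda>s. perm_act s (polytabloid lam T0)) ` ?S" if T: "T \<in> tableaux lam" for T
  proof -
    have b: "bij_betw T (cells lam) {1..r}" using tableau_bij[OF lam T] .
    \<comment> \<open>The permutation carrying the entries of \<open>T0\<close> to those of
      \<open>T\<close>, extended by the identity; \<open>s \<circ> T0\<close> agrees with
      \<open>T\<close> on the cells only.\<close>
    define s where "s x = (if x \<in> {1..r} then T (the_inv_into (cells lam) T0 x) else x)" for x
    have "bij_betw (\<lambda>x. T (the_inv_into (cells lam) T0 x)) {1..r} {1..r}"
      using bij_betw_trans[OF bij_betw_the_inv_into[OF b0] b] by (simp add: comp_def)
    then have "bij_betw s {1..r} {1..r}"
      by (rule bij_betw_cong[THEN iffD1, rotated]) (simp add: s_def)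
    then have s: "s permutes {1..r}" by (rule bij_imp_permutes) (auto simp: s_def)
    have eq: "(s \<circ> T0) c = T c" if "c \<in> cells lam" for c
      using that b0 the_inv_into_f_f[OF bij_betw_imp_inj_on[OF b0] that]
      by (auto simp: s_def bij_betw_def)
    have inv: "the_inv_into (cells lam) (s \<circ> T0) x = the_inv_into (cells lam) T x" if "x \<in> {1..r}" for x
      unfolding the_inv_into_def using eq by (metis (mono_tags, lifting))
    have "polytabloid lam (s \<circ> T0) = polytabloid lam T"
    proof -
      have "tabloid_of lam (s \<circ> T0) = tabloid_of lam T"
        using inv lam by (auto simp: tabloid_of_def partition_of_def fun_eq_iff)
      moreover have "young_sum True r (column_of lam (s \<circ> T0)) = young_sum True r (column_of lam T)"
        by (rule young_sum_cong) (simp add: column_of_def inv)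
      ultimately show ?thesis
        by (simp add: polytabloid_eq_young_sum[OF lam T] polytabloid_eq_young_sum[OF lam tableau_perm_comp[OF lam T0 s]])
    qed
    then show ?thesis
      using perm_act_polytabloid[OF lam T0 s] s by (intro image_eqI[of _ _ s]) simp_all
  qed
  then have "polytabloid lam ` tableaux lam \<subseteq> (\<lambda>s. perm_act s (polytabloid lam T0)) ` ?S" by blast
  then show ?thesis using finite_permutes[of r] finite_subset by blast
qed simp

text \<open>A finite generating set contains a basis, which justifies the choice made in
  \<open>specht_basis\<close>.\<close>

lemma specht_basis_is_basis:
  assumes lam: "partition_of r lam"
  shows "finite (specht_basis lam)" "\<not> mv.dependent (specht_basis lam)"
    "mv.span (specht_basis lam) = specht lam"
proof -
  let ?P = "polytabloid lam ` tableaux lam"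
  obtain B where B: "B \<subseteq> ?P" "\<not> mv.dependent B" "?P \<subseteq> mv.span B"
    using mv.maximal_independent_subset[of ?P] by metis
  have "finite B" using B(1) finite_polytabloids[OF lam] finite_subset by blast
  moreover have sp: "mv.span B = specht lam"
    unfolding specht_def using mv.span_mono[OF B(1)] mv.span_minimal[OF B(3) mv.subspace_span] by blast
  moreover have "B \<subseteq> specht lam" using mv.span_superset sp by blast
  ultimately have "\<exists>B. finite B \<and> B \<subseteq> specht lam \<and> \<not> mv.dependent B \<and> mv.span B = specht lam"
    using B(2) by blast
  from someI_ex[OF this]
  show "finite (specht_basis lam)" "\<not> mv.dependent (specht_basis lam)"
    "mv.span (specht_basis lam) = specht lam"
    unfolding specht_basis_def by blast+
qed

section \<open>Invariants of a subgroup in a Specht module\<close>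

definition perm_subgroup :: "nat \<Rightarrow> (nat \<Rightarrow> nat) set \<Rightarrow> bool" where
  "perm_subgroup r K \<longleftrightarrow> K \<subseteq> {p. p permutes {1..r}} \<and> id \<in> K \<and>
     (\<forall>p\<in>K. \<forall>q\<in>K. p \<circ> q \<in> K) \<and> (\<forall>p\<in>K. inv p \<in> K)"

definition invariants :: "nat list \<Rightarrow> (nat \<Rightarrow> nat) set \<Rightarrow> mvec set" where
  "invariants lam K = {v \<in> specht lam. \<forall>k\<in>K. perm_act k v = v}"

definition orbit_sum :: "(nat \<Rightarrow> nat) set \<Rightarrow> mvec \<Rightarrow> mvec" where
  "orbit_sum K v = (\<Sum>k\<in>K. perm_act k v)"

lemma orbit_sum_apply: "orbit_sum K v f = (\<Sum>k\<in>K. v (f \<circ> k))"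
  by (simp add: orbit_sum_def sum_mvec_apply perm_act_def)

lemma perm_subgroupD:
  assumes "perm_subgroup r K"
  shows "k \<in> K \<Longrightarrow> k permutes {1..r}" "id \<in> K" "p \<in> K \<Longrightarrow> q \<in> K \<Longrightarrow> p \<circ> q \<in> K"
    "p \<in> K \<Longrightarrow> inv p \<in> K" "finite K"
proof -
  show "finite K"
    using assms finite_subset[OF _ finite_permutes[of r]] unfolding perm_subgroup_def by blast
qed (use assms in \<open>unfold perm_subgroup_def, blast+\<close>)

lemma sum_subgroup_comp:
  assumes K: "perm_subgroup r K" and p: "p \<in> K"
  shows "(\<Sum>k\<in>K. F (k \<circ> p)) = (\<Sum>k\<in>K. F k)" "(\<Sum>k\<in>K. F (p \<circ> k)) = (\<Sum>k\<in>K. F k)"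
proof -
  note c = comp_inv_cancel[OF perm_subgroupD(1)[OF K p]]
  show "(\<Sum>k\<in>K. F (k \<circ> p)) = (\<Sum>k\<in>K. F k)"
    by (rule sum.reindex_bij_witness[of _ "\<lambda>k. k \<circ> inv p" "\<lambda>k. k \<circ> p"])
      (use perm_subgroupD[OF K] p c in auto)
  show "(\<Sum>k\<in>K. F (p \<circ> k)) = (\<Sum>k\<in>K. F k)"
    by (rule sum.reindex_bij_witness[of _ "\<lambda>k. inv p \<circ> k" "\<lambda>k. p \<circ> k"])
      (use perm_subgroupD[OF K] p c in auto)
qed

lemma orbit_sum_invariant:
  assumes lam: "partition_of r lam" and K: "perm_subgroup r K" and v: "v \<in> specht lam"
  shows "orbit_sum K v \<in> invariants lam K"
proof -
  have "orbit_sum K v \<in> specht lam"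
    unfolding orbit_sum_def using perm_act_specht[OF lam perm_subgroupD(1)[OF K] v]
    unfolding specht_def by (intro mv.span_sum)
  moreover have "perm_act k (orbit_sum K v) = orbit_sum K v" if k: "k \<in> K" for k
    using sum_subgroup_comp(2)[OF K k, of "\<lambda>k. v (f \<circ> k)" for f]
    by (simp add: fun_eq_iff perm_act_def orbit_sum_apply comp_assoc)
  ultimately show ?thesis by (simp add: invariants_def)
qed

lemma orbit_sum_of_invariant:
  assumes "v \<in> invariants lam K"
  shows "orbit_sum K v = mscale (real (card K)) v"
  using assms by (auto simp: fun_eq_iff orbit_sum_def sum_mvec_apply invariants_def mscale_def)

lemma linear_orbit_sum: "Vector_Spaces.linear mscale mscale (orbit_sum K)"
  by unfold_locales
    (auto simp: mscale_def orbit_sum_apply fun_eq_iff algebra_simps sum.distrib sum_distrib_left)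

text \<open>Averaging over \<open>K\<close> projects the Specht module onto its invariants; the
  trace of this projection is the mean of the character over \<open>K\<close> and also the dimension
  \<open>d\<close> of the invariants.\<close>

lemma sum_irr_char:
  assumes lam: "partition_of r lam" and K: "perm_subgroup r K"
  shows "\<exists>d::nat. (\<Sum>s\<in>K. irr_char lam s) = real (card K) * real d \<and> (d = 0 \<longleftrightarrow> invariants lam K \<subseteq> {0})"
proof -
  define B where "B = specht_basis lam"
  note B = specht_basis_is_basis[OF lam, folded B_def]
  define h where "h v = mscale (1 / real (card K)) (orbit_sum K v)" for v
  have card: "card K \<noteq> 0" using perm_subgroupD(2,5)[OF K] by auto
  have lin: "Vector_Spaces.linear mscale mscale h"
    unfolding h_def
    by unfold_locales
      (auto simp: mscale_def orbit_sum_apply fun_eq_iff algebra_simps sum.distrib sum_distrib_left)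
  have sub: "mv.subspace (invariants lam K)"
    unfolding mv.subspace_def invariants_def specht_def
    by (auto simp: mv.span_zero mv.span_add mv.span_scale)
      (auto simp: fun_eq_iff perm_act_def mscale_def)
  have "\<exists>d::nat. (\<Sum>b\<in>B. mv.representation B (h b) b) = real d \<and> (d = 0 \<longleftrightarrow> invariants lam K \<subseteq> {0})"
  proof (rule trace_projection[OF B(1,2) lin])
    show "invariants lam K \<subseteq> mv.span B" by (auto simp: invariants_def B(3))
    show "h v \<in> invariants lam K" if "v \<in> mv.span B" for v
      unfolding h_def using that orbit_sum_invariant[OF lam K] sub B(3) by (simp add: mv.subspace_scale)
    show "h v = v" if "v \<in> invariants lam K" for v
      using card by (simp add: h_def orbit_sum_of_invariant[OF that] mscale_def)
  qed
  moreover have "(\<Sum>s\<in>K. irr_char lam s) = real (card K) * (\<Sum>b\<in>B. mv.representation B (h b) b)"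
  proof -
    have sB: "perm_act s b \<in> mv.span B" if "s \<in> K" "b \<in> B" for s b
      using perm_act_specht[OF lam perm_subgroupD(1)[OF K]] that mv.span_base[of b B] B(3) by auto
    have "(\<Sum>s\<in>K. mv.representation B (perm_act s b) b) = real (card K) * mv.representation B (h b) b"
      if b: "b \<in> B" for b
    proof -
      have "orbit_sum K b \<in> mv.span B" unfolding orbit_sum_def using sB b by (intro mv.span_sum)
      then have "mv.representation B (h b) b = 1 / real (card K) * mv.representation B (orbit_sum K b) b"
        unfolding h_def by (simp add: mv.representation_scale[OF B(2)])
      also have "mv.representation B (orbit_sum K b) b = (\<Sum>s\<in>K. mv.representation B (perm_act s b) b)"
        unfolding orbit_sum_def using sB b by (subst mv.representation_sum[OF B(2)]) auto
      finally show ?thesis using card by simp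
    qed
    then show ?thesis
      unfolding irr_char_def B_def[symmetric] by (subst sum.swap) (simp add: sum_distrib_left)
  qed
  ultimately show ?thesis by metis
qed

text \<open>An odd column permutation in \<open>K\<close> negates the polytabloid, while the orbit
  sum absorbs it. If every tableau had one, the orbit sum would vanish on the whole Specht module,
  yet it multiplies an invariant vector by \<open>card K\<close>.\<close>

lemma invariants_nonzero_imp_even_tableau:
  assumes lam: "partition_of r lam" and K: "perm_subgroup r K" and nz: "\<not> invariants lam K \<subseteq> {0}"
  shows "\<exists>T\<in>tableaux lam. \<forall>p\<in>young r (column_of lam T) \<inter> K. sign p = 1"
proof (rule ccontr)
  assume "\<not> ?thesis"
  then have odd: "\<exists>p\<in>young r (column_of lam T) \<inter> K. sign p = -1" if "T \<in> tableaux lam" for T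
    using that by (metis sign_cases)
  have zero: "orbit_sum K (polytabloid lam T) = 0" if T: "T \<in> tableaux lam" for T
  proof -
    obtain p where p: "p \<in> young r (column_of lam T)" "p \<in> K" "sign p = -1" using odd[OF T] by blast
    have "polytabloid lam T (f \<circ> p) = - polytabloid lam T f" for f
      using perm_act_young_sum[OF p(1), of True] p(3)
      by (simp add: polytabloid_eq_young_sum[OF lam T] perm_weight_def)
    then have "orbit_sum K (polytabloid lam T) f = - orbit_sum K (polytabloid lam T) f" for f
      using sum_subgroup_comp(1)[OF K p(2), of "\<lambda>k. polytabloid lam T (f \<circ> k)"]
      by (simp add: orbit_sum_apply comp_assoc[symmetric] sum_negf)
    then show ?thesis by (simp add: fun_eq_iff)
  qed
  interpret o: Vector_Spaces.linear mscale mscale "orbit_sum K" by (rule linear_orbit_sum)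
  have "orbit_sum K v = 0" if "v \<in> specht lam" for v
    using o.eq_0_on_span[of "polytabloid lam ` tableaux lam" v] zero that unfolding specht_def by blast
  moreover obtain v where v: "v \<in> invariants lam K" "v \<noteq> 0" using nz by blast
  ultimately have "mscale (real (card K)) v = 0"
    using orbit_sum_of_invariant[OF v(1)] v(1) by (simp add: invariants_def)
  moreover have "card K \<noteq> 0" using perm_subgroupD(2,5)[OF K] by auto
  ultimately show False using v(2) by (simp add: mscale_def fun_eq_iff)
qed

text \<open>Transfers nonvanishing from functions on permutations to functions on tabloids: the
  value at \<open>g\<close> of the double Young sum is a coefficient of the orbit sum of the
  polytabloid.\<close>

lemma invariants_nonzero:
  assumes lam: "partition_of r lam" and K: "perm_subgroup r K" and T: "T \<in> tableaux lam"
    and nz: "young_sum False r (tabloid_of lam T) (young_sum True r (column_of lam T) (\<lambda>f. of_bool (f \<in> K))) \<noteq> (\<lambda>_. 0)"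
  shows "\<not> invariants lam K \<subseteq> {0}"
proof -
  define R where "R = young r (tabloid_of lam T)"
  define C where "C = young r (column_of lam T)"
  have finR: "finite R" and finC: "finite C" unfolding R_def C_def by (rule finite_young)+
  have Cp: "p permutes {1..r}" if "p \<in> C" for p using that unfolding C_def by (rule young_permutes)
  have Rp: "p permutes {1..r}" if "p \<in> R" for p using that unfolding R_def by (rule young_permutes)
  obtain g where "(\<Sum>q\<in>R. \<Sum>p\<in>C. real_of_int (sign p) * of_bool (g \<circ> q \<circ> p \<in> K)) \<noteq> 0"
    using nz by (auto simp: young_sum_def perm_weight_def R_def C_def fun_eq_iff)
  then have g_nz: "(\<Sum>p\<in>C. real_of_int (sign p) * real (card {q\<in>R. g \<circ> q \<circ> p \<in> K})) \<noteq> 0"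
    by (subst (asm) sum.swap) (simp add: card_filter_sum[OF finR] sum_distrib_left)
  then have "\<exists>p\<in>C. {q\<in>R. g \<circ> q \<circ> p \<in> K} \<noteq> {}"
    by (metis (no_types, lifting) card.empty mult_zero_right of_nat_0 sum.neutral)
  then obtain p q where pq: "p \<in> C" "q \<in> R" "g \<circ> q \<circ> p \<in> K" by blast
  \<comment> \<open>Vectors are evaluated at arbitrary maps; a nonzero value forces this one to be a
    permutation.\<close>
  have g: "g permutes {1..r}"
  proof -
    have "g \<circ> q \<circ> p \<circ> inv p \<circ> inv q = g"
      by (simp add: comp_inv_cancel(1)[OF Cp[OF pq(1)]] comp_inv_cancel(1)[OF Rp[OF pq(2)]])
    moreover have "g \<circ> q \<circ> p \<circ> inv p \<circ> inv q permutes {1..r}"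
      by (rule permutes_compose[OF permutes_inv[OF Rp[OF pq(2)]]
            permutes_compose[OF permutes_inv[OF Cp[OF pq(1)]] perm_subgroupD(1)[OF K pq(3)]]])
    ultimately show ?thesis by simp
  qed
  \<comment> \<open>The condition on \<open>k\<close> says that
    \<open>inv g \<circ> k \<circ> p\<close> preserves rows, which makes it the element
    \<open>q\<close> of \<open>R\<close>.\<close>
  have fib: "card {k\<in>K. tabloid_of lam T \<circ> inv g \<circ> k \<circ> p = tabloid_of lam T} =
      card {q\<in>R. g \<circ> q \<circ> inv p \<in> K}" if p: "p \<in> C" for p
  proof (rule bij_betw_same_card[of "\<lambda>k. inv g \<circ> k \<circ> p"], rule bij_betw_byWitness[of _ "\<lambda>q. g \<circ> q \<circ> inv p"])
    note cp = comp_inv_cancel[OF Cp[OF p]] and cg = comp_inv_cancel[OF g]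
    show "\<forall>k\<in>{k\<in>K. tabloid_of lam T \<circ> inv g \<circ> k \<circ> p = tabloid_of lam T}. g \<circ> (inv g \<circ> k \<circ> p) \<circ> inv p = k"
      by (simp add: comp_assoc permutes_inv_o[OF Cp[OF p]] cg)
    show "\<forall>q\<in>{q\<in>R. g \<circ> q \<circ> inv p \<in> K}. inv g \<circ> (g \<circ> q \<circ> inv p) \<circ> p = q"
      by (simp add: comp_assoc permutes_inv_o[OF Cp[OF p]] cg)
    show "(\<lambda>k. inv g \<circ> k \<circ> p) ` {k\<in>K. tabloid_of lam T \<circ> inv g \<circ> k \<circ> p = tabloid_of lam T} \<subseteq>
        {q\<in>R. g \<circ> q \<circ> inv p \<in> K}"
    proof safe
      fix k assume k: "k \<in> K" "tabloid_of lam T \<circ> inv g \<circ> k \<circ> p = tabloid_of lam T"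
      have "inv g \<circ> k \<circ> p permutes {1..r}"
        using perm_subgroupD(1)[OF K k(1)] Cp[OF p] g by (intro permutes_compose permutes_inv)
      moreover have "tabloid_of lam T ((inv g \<circ> k \<circ> p) x) = tabloid_of lam T x" for x
        using fun_cong[OF k(2), of x] by simp
      ultimately show "inv g \<circ> k \<circ> p \<in> R" unfolding R_def young_def by blast
      show "g \<circ> (inv g \<circ> k \<circ> p) \<circ> inv p \<in> K"
        using k(1) by (simp add: comp_assoc permutes_inv_o[OF Cp[OF p]] cg)
    qed
    show "(\<lambda>q. g \<circ> q \<circ> inv p) ` {q\<in>R. g \<circ> q \<circ> inv p \<in> K} \<subseteq>
        {k\<in>K. tabloid_of lam T \<circ> inv g \<circ> k \<circ> p = tabloid_of lam T}"
    proof safe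
      fix q assume q: "q \<in> R" "g \<circ> q \<circ> inv p \<in> K"
      have "tabloid_of lam T (q x) = tabloid_of lam T x" for x
      proof (cases "x \<in> {1..r}")
        case True
        then show ?thesis using q(1) by (simp add: R_def young_def)
      next
        case False
        then show ?thesis using permutes_not_in[OF Rp[OF q(1)]] by simp
      qed
      then have "tabloid_of lam T \<circ> q = tabloid_of lam T" by auto
      then show "tabloid_of lam T \<circ> inv g \<circ> (g \<circ> q \<circ> inv p) \<circ> p = tabloid_of lam T"
        by (simp add: comp_assoc permutes_inv_o[OF Cp[OF p]] cg)
    qed
  qed
  have "orbit_sum K (polytabloid lam T) (tabloid_of lam T \<circ> inv g) =
      (\<Sum>k\<in>K. \<Sum>p\<in>C. real_of_int (sign p) * of_bool (tabloid_of lam T \<circ> inv g \<circ> k \<circ> p = tabloid_of lam T))"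
    by (simp add: orbit_sum_apply polytabloid_eq_young_sum[OF lam T] young_sum_def perm_weight_def C_def)
  also have "\<dots> = (\<Sum>p\<in>C. real_of_int (sign p) *
      real (card {k\<in>K. tabloid_of lam T \<circ> inv g \<circ> k \<circ> p = tabloid_of lam T}))"
    by (subst sum.swap) (simp add: card_filter_sum[OF perm_subgroupD(5)[OF K]] sum_distrib_left)
  also have "\<dots> = (\<Sum>p\<in>C. real_of_int (sign p) * real (card {q\<in>R. g \<circ> q \<circ> inv p \<in> K}))"
    by (simp add: fib)
  \<comment> \<open>Inversion permutes the column group and preserves signs.\<close>
  also have "\<dots> = (\<Sum>p\<in>C. real_of_int (sign p) * real (card {q\<in>R. g \<circ> q \<circ> p \<in> K}))"
    by (rule sum.reindex_bij_witness[of _ inv inv])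
      (use young_inv[of _ r "column_of lam T"] in
        \<open>auto simp: C_def sign_inverse[OF permutation_interval[OF Cp[unfolded C_def]]]
          permutes_inv_inv[OF Cp[unfolded C_def]]\<close>)
  finally have "orbit_sum K (polytabloid lam T) (tabloid_of lam T \<circ> inv g) \<noteq> 0" using g_nz by simp
  then have "orbit_sum K (polytabloid lam T) \<noteq> 0" by auto
  moreover have "polytabloid lam T \<in> specht lam" unfolding specht_def using T by (intro mv.span_base) blast
  ultimately show ?thesis using orbit_sum_invariant[OF lam K] by blast
qed

section \<open>Multiplicities in the Foulkes character\<close>

definition block_stabilizer :: "nat \<Rightarrow> nat set set \<Rightarrow> (nat \<Rightarrow> nat) set" where
  "block_stabilizer r P = {s. s permutes {1..r} \<and> (\<lambda>X. s ` X) ` P = P}"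

lemma image_blocks_comp: "(\<lambda>X. (p \<circ> q) ` X) ` P = (\<lambda>X. p ` X) ` (\<lambda>X. q ` X) ` P"
  by (simp add: image_image image_comp)

lemma image_blocks_inv:
  assumes "p permutes S" "(\<lambda>X. p ` X) ` P = Q"
  shows "(\<lambda>X. inv p ` X) ` Q = P"
  using assms permutes_inv_o[OF assms(1)] image_blocks_comp[of "inv p" p P] by auto

lemma perm_subgroup_block_stabilizer: "perm_subgroup r (block_stabilizer r P)"
  unfolding perm_subgroup_def
proof (intro conjI ballI)
  show "block_stabilizer r P \<subseteq> {p. p permutes {1..r}}" by (auto simp: block_stabilizer_def)
  show "id \<in> block_stabilizer r P" by (simp add: block_stabilizer_def permutes_id)
  show "p \<circ> q \<in> block_stabilizer r P" if "p \<in> block_stabilizer r P" "q \<in> block_stabilizer r P" for p q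
    using that permutes_compose[of q "{1..r}" p] image_blocks_comp[of p q P]
    by (simp add: block_stabilizer_def)
  show "inv p \<in> block_stabilizer r P" if "p \<in> block_stabilizer r P" for p
    using that permutes_inv[of p "{1..r}"] image_blocks_inv[of p "{1..r}" P P]
    by (simp add: block_stabilizer_def)
qed

lemma finite_set_partitions_mn: "finite (set_partitions_mn m n)"
proof (rule finite_subset)
  show "set_partitions_mn m n \<subseteq> Pow (Pow {1..m * n})"
    by (auto simp: set_partitions_mn_def partition_on_def)
qed simp

lemma set_partitions_mn_perm:
  assumes P: "P \<in> set_partitions_mn m n" and s: "s permutes {1..m * n}"
  shows "(\<lambda>X. s ` X) ` P \<in> set_partitions_mn m n"
proof -
  have inj: "inj s" using permutes_inj[OF s] .
  have injP: "inj_on ((`) s) P" using inj by (simp add: inj_on_def inj_image_eq_iff)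
  have part: "partition_on {1..m * n} P" and c: "card P = n" "\<And>X. X \<in> P \<Longrightarrow> card X = m"
    using P by (auto simp: set_partitions_mn_def)
  have "partition_on {1..m * n} ((`) s ` P)"
  proof (rule partition_onI)
    show "\<Union> ((`) s ` P) = {1..m * n}"
      using partition_onD1[OF part] permutes_image[OF s] by (metis image_Union)
    show "disjnt p q" if "p \<in> (`) s ` P" "q \<in> (`) s ` P" "p \<noteq> q" for p q
    proof -
      obtain X Y where XY: "X \<in> P" "Y \<in> P" "p = s ` X" "q = s ` Y" "X \<noteq> Y"
        using \<open>p \<in> _\<close> \<open>q \<in> _\<close> \<open>p \<noteq> q\<close> by blast
      then have "X \<inter> Y = {}" using partition_onD2[OF part] by (auto simp: disjoint_def)
      then show ?thesis unfolding XY disjnt_def image_Int[OF inj, symmetric] by simp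
    qed
    show "{} \<notin> (`) s ` P" using partition_onD3[OF part] by auto
  qed
  moreover have "card (s ` X) = m" if "X \<in> P" for X
    using c(2)[OF that] card_image[OF inj_on_subset[OF inj subset_UNIV]] by metis
  ultimately show ?thesis
    using c(1) card_image[OF injP] by (auto simp: set_partitions_mn_def)
qed

text \<open>The stabilizer of the image is the conjugate by \<open>s\<close>, so the invertible map
  \<open>perm_act s\<close> carries invariants to invariants.\<close>

lemma invariants_transport:
  assumes lam: "partition_of r lam" and s: "s permutes {1..r}"
    and nz: "\<not> invariants lam (block_stabilizer r P) \<subseteq> {0}"
  shows "\<not> invariants lam (block_stabilizer r ((\<lambda>X. s ` X) ` P)) \<subseteq> {0}"
proof -
  let ?Q = "(\<lambda>X. s ` X) ` P"
  obtain v where v: "v \<in> specht lam" "\<And>k. k \<in> block_stabilizer r P \<Longrightarrow> perm_act k v = v" "v \<noteq> 0"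
    using nz by (auto simp: invariants_def)
  have "perm_act k (perm_act s v) = perm_act s v" if k: "k \<in> block_stabilizer r ?Q" for k
  proof
    fix f
    have kp: "k permutes {1..r}" using k by (simp add: block_stabilizer_def)
    let ?k = "inv s \<circ> (k \<circ> s)"
    have "?k permutes {1..r}"
      using permutes_compose[OF permutes_compose[OF s kp] permutes_inv[OF s]] .
    moreover have "(\<lambda>X. ?k ` X) ` P = P"
    proof -
      have "(\<lambda>X. (k \<circ> s) ` X) ` P = ?Q"
        using k unfolding image_blocks_comp by (simp add: block_stabilizer_def)
      then show ?thesis
        unfolding image_blocks_comp[of "inv s" "k \<circ> s"] using image_blocks_inv[OF s refl] by simp
    qed
    ultimately have "perm_act ?k v = v" using v(2) by (simp add: block_stabilizer_def)
    then have "v (f \<circ> s \<circ> ?k) = v (f \<circ> s)" by (metis perm_act_def)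
    moreover have "f \<circ> s \<circ> ?k = f \<circ> k \<circ> s"
      by (simp add: comp_assoc comp_inv_cancel(3)[OF s])
    ultimately show "perm_act k (perm_act s v) f = perm_act s v f" by (simp add: perm_act_def)
  qed
  then have "perm_act s v \<in> invariants lam (block_stabilizer r ?Q)"
    using perm_act_specht[OF lam s v(1)] by (simp add: invariants_def)
  moreover have "perm_act s v \<noteq> 0"
  proof
    assume "perm_act s v = 0"
    then have "perm_act s v (f \<circ> inv s) = 0" for f by simp
    then have "v (f \<circ> inv s \<circ> s) = 0" for f by (simp only: perm_act_def)
    then show False using v(3) by (simp add: comp_inv_cancel(2)[OF s] fun_eq_iff)
  qed
  ultimately show ?thesis by blast
qed

text \<open>Pairs of a permutation and a set partition fixed by it are summed by the partition
  instead of the permutation, an elementary form of Frobenius reciprocity.\<close>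

lemma char_inner_foulkes:
  "char_inner (m * n) (foulkes_char m n) chi =
    (\<Sum>P\<in>set_partitions_mn m n. \<Sum>s\<in>block_stabilizer (m * n) P. chi s) / fact (m * n)"
proof -
  let ?G = "{s. s permutes {1..m * n}}"
  have "(\<Sum>s\<in>?G. foulkes_char m n s * chi s) =
      (\<Sum>s\<in>?G. \<Sum>P\<in>{P\<in>set_partitions_mn m n. (\<lambda>X. s ` X) ` P = P}. chi s)"
    by (simp add: foulkes_char_def)
  also have "\<dots> = (\<Sum>P\<in>set_partitions_mn m n. \<Sum>s\<in>{s\<in>?G. (\<lambda>X. s ` X) ` P = P}. chi s)"
    by (rule sum.swap_restrict[OF finite_permutes finite_set_partitions_mn])
  finally show ?thesis by (simp add: char_inner_def block_stabilizer_def)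
qed

lemma foulkes_multiplicity_zero:
  assumes lam: "partition_of (m * n) lam"
    and "\<And>P. P \<in> set_partitions_mn m n \<Longrightarrow> invariants lam (block_stabilizer (m * n) P) \<subseteq> {0}"
  shows "char_inner (m * n) (foulkes_char m n) (irr_char lam) = 0"
proof -
  have "(\<Sum>s\<in>block_stabilizer (m * n) P. irr_char lam s) = 0" if "P \<in> set_partitions_mn m n" for P
    using sum_irr_char[OF lam perm_subgroup_block_stabilizer[of "m * n" P]] assms(2)[OF that] by auto
  then show ?thesis by (simp add: char_inner_foulkes)
qed

text \<open>The fibres of the orbit map of \<open>P\<close> exhaust the symmetric group. Each is at
  most as large as the stabilizer of its image, hence at most the character sum there, since
  \<open>d\<close> is nonzero along the orbit. All other character sums are nonnegative, so the
  total is at least the factorial.\<close>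

lemma foulkes_multiplicity_ge_1:
  assumes lam: "partition_of (m * n) lam" and P: "P \<in> set_partitions_mn m n"
    and nz: "\<not> invariants lam (block_stabilizer (m * n) P) \<subseteq> {0}"
  shows "1 \<le> char_inner (m * n) (foulkes_char m n) (irr_char lam)"
proof -
  let ?r = "m * n"
  let ?G = "{s. s permutes {1..?r}}"
  let ?O = "(\<lambda>s. (\<lambda>X. s ` X) ` P) ` ?G"
  let ?S = "\<lambda>Q. \<Sum>s\<in>block_stabilizer ?r Q. irr_char lam s"
  have O: "?O \<subseteq> set_partitions_mn m n" using set_partitions_mn_perm[OF P] by blast
  have finO: "finite ?O" using finite_permutes by blast
  have pos: "0 \<le> ?S Q" for Q
    using sum_irr_char[OF lam perm_subgroup_block_stabilizer[of ?r Q]] by auto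
  have fib: "real (card {s\<in>?G. (\<lambda>X. s ` X) ` P = Q}) \<le> ?S Q" if Q: "Q \<in> ?O" for Q
  proof -
    obtain t where t: "t permutes {1..?r}" "Q = (\<lambda>X. t ` X) ` P" using Q by blast
    note K = perm_subgroup_block_stabilizer[of ?r Q]
    obtain d :: nat where d: "?S Q = real (card (block_stabilizer ?r Q)) * real d"
        "d = 0 \<longleftrightarrow> invariants lam (block_stabilizer ?r Q) \<subseteq> {0}"
      using sum_irr_char[OF lam K] by (elim exE conjE)
    have "d \<noteq> 0" using d(2) invariants_transport[OF lam t(1) nz] unfolding t(2) by simp
    have "(\<lambda>s. s \<circ> inv t) ` {s\<in>?G. (\<lambda>X. s ` X) ` P = Q} \<subseteq> block_stabilizer ?r Q"
    proof safe
      fix s assume s: "s permutes {1..?r}" "Q = (\<lambda>X. s ` X) ` P"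
      have "(\<lambda>X. inv t ` X) ` Q = P" using image_blocks_inv[OF t(1) t(2)[symmetric]] .
      then have "(\<lambda>X. (s \<circ> inv t) ` X) ` Q = Q" unfolding image_blocks_comp using s(2) by simp
      then show "s \<circ> inv t \<in> block_stabilizer ?r ((\<lambda>X. s ` X) ` P)"
        using permutes_compose[OF permutes_inv[OF t(1)] s(1)] s(2) by (simp add: block_stabilizer_def)
    qed
    moreover have "inj_on (\<lambda>s. s \<circ> inv t) {s\<in>?G. (\<lambda>X. s ` X) ` P = Q}"
      by (rule inj_onI) (metis comp_inv_cancel(2)[OF t(1)])
    ultimately have "card {s\<in>?G. (\<lambda>X. s ` X) ` P = Q} \<le> card (block_stabilizer ?r Q)"
      using card_inj_on_le perm_subgroupD(5)[OF K] by blast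
    also have "\<dots> \<le> card (block_stabilizer ?r Q) * d" using \<open>d \<noteq> 0\<close> by simp
    finally show ?thesis unfolding d(1) of_nat_mult[symmetric] of_nat_le_iff .
  qed
  have "fact ?r = real (card ?G)" by (simp add: card_permutations[OF refl finite_atLeastAtMost])
  also have "\<dots> = (\<Sum>Q\<in>?O. real (card {s\<in>?G. (\<lambda>X. s ` X) ` P = Q}))"
    using sum.group[OF finite_permutes[of ?r] finO subset_refl, of "\<lambda>_. 1 :: nat"]
    by (simp add: of_nat_sum[symmetric] del: of_nat_sum)
  also have "\<dots> \<le> (\<Sum>Q\<in>?O. ?S Q)" by (rule sum_mono) (rule fib)
  also have "\<dots> \<le> (\<Sum>Q\<in>set_partitions_mn m n. ?S Q)"
    by (rule sum_mono2[OF finite_set_partitions_mn O]) (rule pos)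
  finally show ?thesis by (simp add: char_inner_foulkes)
qed

text \<open>With the indicator function of the stabilizer as \<open>u\<close>, the hypotheses of
  \<open>exists_tableau_sums_nonzero\<close> follow from parity conditions on the intersections of
  Young subgroups with the stabilizer.\<close>

lemma foulkes_constituent_of_labelling:
  assumes lam: "partition_of (m * n) lam" and P: "P \<in> set_partitions_mn m n"
    and size: "\<And>j. card {x\<in>{1..m * n}. g x = j} = conj_part lam (Suc j)"
    and even: "\<And>p. p \<in> young (m * n) g \<inter> block_stabilizer (m * n) P \<Longrightarrow> sign p = 1"
    and lower: "\<And>x j. x \<in> {1..m * n} \<Longrightarrow> j < g x \<Longrightarrow>
      \<exists>p\<in>young (m * n) (g(x := j)) \<inter> block_stabilizer (m * n) P. sign p \<noteq> 1"
  shows "1 \<le> char_inner (m * n) (foulkes_char m n) (irr_char lam)"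
proof -
  let ?r = "m * n"
  define K where "K = block_stabilizer ?r P"
  have K: "perm_subgroup ?r K" unfolding K_def by (rule perm_subgroup_block_stabilizer)
  define u :: mvec where "u = (\<lambda>f. of_bool (f \<in> K))"
  \<comment> \<open>At the identity only elements of \<open>K\<close> contribute, all with sign 1,
    so nothing cancels.\<close>
  have "young_sum True ?r g u id = (\<Sum>p\<in>young ?r g. real_of_int (sign p) * of_bool (p \<in> K))"
    by (simp add: young_sum_def u_def perm_weight_def)
  also have "\<dots> = (\<Sum>p\<in>young ?r g. of_bool (p \<in> K))"
    by (rule sum.cong[OF refl]) (use even in \<open>auto simp: K_def\<close>)
  also have "\<dots> = real (card {p\<in>young ?r g. p \<in> K})"
    by (simp add: card_filter_sum[OF finite_young])
  also have "\<dots> \<noteq> 0"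
    using finite_young[of ?r g] id_in_young[of ?r g] perm_subgroupD(2)[OF K] by auto
  finally have nz: "young_sum True ?r g u \<noteq> (\<lambda>_. 0)" by auto
  \<comment> \<open>An odd element of the intersection fixes \<open>u\<close> and is absorbed with
    weight -1, so the Young sum equals its own negative.\<close>
  have "young_sum True ?r (g(x := j)) u = (\<lambda>_. 0)" if x: "x \<in> {1..?r}" and j: "j < g x" for x j
  proof
    fix f
    obtain p where p: "p \<in> young ?r (g(x := j))" "p \<in> K" "sign p = -1"
      using lower[OF x j] unfolding K_def by (metis IntD1 IntD2 sign_cases)
    have "f \<circ> p \<in> K \<longleftrightarrow> f \<in> K" for f
      using perm_subgroupD(3,4)[OF K] p(2) comp_inv_cancel(1)[OF perm_subgroupD(1)[OF K p(2)]] by metis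
    then have "perm_act p u = u" by (simp add: perm_act_def u_def)
    then show "young_sum True ?r (g(x := j)) u f = 0"
      using young_sum_perm_act_absorb[OF p(1), of True u f] p(3) by (simp add: perm_weight_def)
  qed
  then obtain T where "T \<in> tableaux lam"
      "young_sum False ?r (tabloid_of lam T) (young_sum True ?r (column_of lam T) u) \<noteq> (\<lambda>_. 0)"
    using exists_tableau_sums_nonzero[OF lam size nz] by blast
  then have "\<not> invariants lam K \<subseteq> {0}" using invariants_nonzero[OF lam K] unfolding u_def by blast
  then show ?thesis using foulkes_multiplicity_ge_1[OF lam P] unfolding K_def by blast
qed

section \<open>Set families and labellings\<close>

lemma set_partitions_mnD:
  assumes "P \<in> set_partitions_mn m n"
  shows "partition_on {1..m * n} P" "card P = n" "X \<in> P \<Longrightarrow> card X = m"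
    "X \<in> P \<Longrightarrow> X \<subseteq> {1..m * n}" "X \<in> P \<Longrightarrow> finite X" "finite P"
    "X \<in> P \<Longrightarrow> Y \<in> P \<Longrightarrow> X \<noteq> Y \<Longrightarrow> X \<inter> Y = {}" "\<Union>P = {1..m * n}"
proof -
  show part: "partition_on {1..m * n} P" and "card P = n" "X \<in> P \<Longrightarrow> card X = m"
    using assms by (auto simp: set_partitions_mn_def)
  show U: "\<Union>P = {1..m * n}" using partition_onD1[OF part] by simp
  then show sub: "X \<in> P \<Longrightarrow> X \<subseteq> {1..m * n}" by blast
  then show "X \<in> P \<Longrightarrow> finite X" using finite_subset by blast
  show "finite P" using finite_elements[OF _ part] by simp
  show "X \<in> P \<Longrightarrow> Y \<in> P \<Longrightarrow> X \<noteq> Y \<Longrightarrow> X \<inter> Y = {}"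
    using partition_onD2[OF part] by (auto simp: disjoint_def)
qed

text \<open>The permutation is a product of one transposition for each element of \<open>X\<close>,
  all disjoint, which gives the sign.\<close>

lemma exists_swap_along_bij:
  assumes "finite X" "inj_on f X" "X \<inter> f ` X = {}"
  shows "\<exists>p. p permutes X \<union> f ` X \<and> (\<forall>x\<in>X. p x = f x \<and> p (f x) = x) \<and> sign p = (-1) ^ card X"
  using assms
proof (induction X rule: finite_induct)
  case empty
  show ?case by (intro exI[of _ id]) (auto simp: permutes_id)
next
  case (insert a X)
  obtain p where p: "p permutes X \<union> f ` X" "\<And>x. x \<in> X \<Longrightarrow> p x = f x" "\<And>x. x \<in> X \<Longrightarrow> p (f x) = x"
      "sign p = (-1) ^ card X"
    using insert by auto
  have a: "a \<notin> X \<union> f ` X" and fa: "f a \<notin> X \<union> f ` X" and ne: "a \<noteq> f a"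
    using insert.hyps(2) insert.prems by auto
  let ?q = "Transposition.transpose a (f a) \<circ> p"
  have fin: "finite (insert a X \<union> f ` insert a X)" using insert.hyps(1) by simp
  have p': "p permutes insert a X \<union> f ` insert a X" using p(1) by (rule permutes_subset) auto
  have t: "Transposition.transpose a (f a) permutes insert a X \<union> f ` insert a X"
    by (rule permutes_swap_id) auto
  have "?q permutes insert a X \<union> f ` insert a X" using permutes_compose[OF p' t] .
  moreover have "\<forall>x\<in>insert a X. ?q x = f x \<and> ?q (f x) = x"
  proof
    fix x assume x: "x \<in> insert a X"
    show "?q x = f x \<and> ?q (f x) = x"
    proof (cases "x = a")
      case True
      have "p a = a" "p (f a) = f a" using permutes_not_in[OF p(1)] a fa by auto
      then show ?thesis using True by simp
    next
      case False
      then have "x \<in> X" using x by simp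
      moreover from this have "f x \<noteq> a" "f x \<noteq> f a" "x \<noteq> a" "x \<noteq> f a"
        using a fa by (metis UnI1 UnI2 imageI)+
      ultimately show ?thesis using p(2,3) by simp
    qed
  qed
  moreover have "sign ?q = (-1) ^ card (insert a X)"
  proof -
    have "permutation p" "permutation (Transposition.transpose a (f a))"
      using p' t fin permutation_permutes by blast+
    then show ?thesis
      using sign_compose[of "Transposition.transpose a (f a)" p] p(4) ne insert.hyps(1,2)
      by (simp add: sign_swap_id)
  qed
  ultimately show ?case by blast
qed

text \<open>Matching points of equal label makes the exchange label-preserving; it is a product of
  \<open>m\<close> transpositions. Its parity is what separates even from odd
  \<open>m\<close>.\<close>

lemma exists_block_swap:
  assumes P: "P \<in> set_partitions_mn m n" and X: "X \<in> P" and Y: "Y \<in> P" and ne: "X \<noteq> Y"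
    and inj: "inj_on g X" "inj_on g Y" and im: "g ` X = g ` Y"
  shows "\<exists>q. q \<in> young (m * n) g \<and> q \<in> block_stabilizer (m * n) P \<and> q ` X = Y \<and> q ` Y = X \<and>
    (\<forall>Z\<in>P. Z \<noteq> X \<longrightarrow> Z \<noteq> Y \<longrightarrow> q ` Z = Z) \<and> sign q = (-1) ^ m"
proof -
  note PD = set_partitions_mnD[OF P]
  define f where "f x = inv_into Y g (g x)" for x
  have gx: "g x \<in> g ` Y" if "x \<in> X" for x using that im by blast
  have gf: "g (f x) = g x" and fY: "f x \<in> Y" if "x \<in> X" for x
    using f_inv_into_f[OF gx[OF that]] inv_into_into[OF gx[OF that]] by (simp_all add: f_def)
  have finj: "inj_on f X" using gf inj(1) by (metis inj_on_def)
  have fim: "f ` X = Y"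
  proof (rule card_subset_eq)
    show "finite Y" using PD(5)[OF Y] .
    show "f ` X \<subseteq> Y" using fY by blast
    show "card (f ` X) = card Y" using card_image[OF finj] PD(3) X Y by simp
  qed
  have disj: "X \<inter> Y = {}" using PD(7)[OF X Y ne] .
  obtain q where q: "q permutes X \<union> Y" "\<And>x. x \<in> X \<Longrightarrow> q x = f x" "\<And>x. x \<in> X \<Longrightarrow> q (f x) = x"
      "sign q = (-1) ^ card X"
    using exists_swap_along_bij[OF PD(5)[OF X] finj] unfolding fim using disj by blast
  have qp: "q permutes {1..m * n}" using permutes_subset[OF q(1)] PD(4) X Y by simp
  have "g (q x) = g x" for x
  proof -
    consider "x \<in> X" | "x \<in> f ` X" | "x \<notin> X \<union> Y" using fim by blast
    then show ?thesis
    proof cases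
      case 3
      then show ?thesis using permutes_not_in[OF q(1)] by simp
    qed (use q(2,3) gf in auto)
  qed
  then have qy: "q \<in> young (m * n) g" using qp by (simp add: young_def)
  have qX: "q ` X = Y" using q(2) fim by auto
  have qY: "q ` Y = X" using q(3) fim by (force simp: image_image)
  have qZ: "q ` Z = Z" if "Z \<in> P" "Z \<noteq> X" "Z \<noteq> Y" for Z
  proof -
    have "Z \<inter> (X \<union> Y) = {}" using PD(7) that X Y by blast
    then have "q z = z" if "z \<in> Z" for z using that permutes_not_in[OF q(1)] by blast
    then show ?thesis by simp
  qed
  have "(\<lambda>Z. q ` Z) ` P = P"
  proof -
    have "q ` Z \<in> P \<and> (\<exists>W\<in>P. q ` W = Z)" if Z: "Z \<in> P" for Z
    proof -
      consider "Z = X" | "Z = Y" | "Z \<noteq> X" "Z \<noteq> Y" by blast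
      then show ?thesis
      proof cases
        case 1
        then show ?thesis using qX qY X Y by metis
      next
        case 2
        then show ?thesis using qX qY X Y by metis
      next
        case 3
        then have "q ` Z = Z" using qZ[OF Z] by blast
        then show ?thesis using Z by auto
      qed
    qed
    then show ?thesis by blast
  qed
  then have "q \<in> block_stabilizer (m * n) P" using qp by (simp add: block_stabilizer_def)
  moreover have "sign q = (-1) ^ m" using q(4) PD(3)[OF X] by simp
  ultimately show ?thesis using qy qX qY qZ by (intro exI[of _ q] conjI ballI impI)
qed

text \<open>Two points of a block with equal labels would give a transposition fixing every block,
  an odd element of the intersection.\<close>

lemma inj_on_block:
  assumes P: "P \<in> set_partitions_mn m n" and X: "X \<in> P"
    and even: "\<And>p. p \<in> young (m * n) g \<inter> block_stabilizer (m * n) P \<Longrightarrow> sign p = 1"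
  shows "inj_on g X"
proof (rule inj_onI, rule ccontr)
  fix x y assume xy: "x \<in> X" "y \<in> X" "g x = g y" "x \<noteq> y"
  note PD = set_partitions_mnD[OF P]
  have r: "x \<in> {1..m * n}" "y \<in> {1..m * n}" using PD(4)[OF X] xy by auto
  have fixed: "swap x y ` Z = Z" if "Z \<in> P" for Z
  proof (cases "Z = X")
    case True
    then show ?thesis using xy by (simp add: transpose_image_eq)
  next
    case False
    then have "x \<notin> Z" "y \<notin> Z" using PD(7)[OF X that] xy by auto
    then show ?thesis by (simp add: transpose_image_eq)
  qed
  have "(\<lambda>Z. swap x y ` Z) ` P = (\<lambda>Z. Z) ` P" by (rule image_cong[OF refl]) (rule fixed)
  then have "swap x y \<in> block_stabilizer (m * n) P"
    using permutes_swap_id[OF r] by (simp add: block_stabilizer_def)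
  then have "sign (swap x y) = 1" using even transpose_in_young[OF r xy(3)] by blast
  then show False using xy(4) by (simp add: sign_swap_id)
qed

lemma card_label_eq:
  assumes P: "P \<in> set_partitions_mn m n" and inj: "\<And>X. X \<in> P \<Longrightarrow> inj_on g X"
  shows "card {x\<in>{1..m * n}. g x = j} = card {X\<in>P. j \<in> g ` X}"
proof -
  note PD = set_partitions_mnD[OF P]
  have "{x\<in>{1..m * n}. g x = j} = (\<Union>X\<in>P. {x\<in>X. g x = j})" using PD(8) by blast
  then have "card {x\<in>{1..m * n}. g x = j} = card (\<Union>X\<in>P. {x\<in>X. g x = j})" by (rule arg_cong)
  also have "\<dots> = (\<Sum>X\<in>P. card {x\<in>X. g x = j})"
    by (rule card_UN_disjoint) (use PD(5,6,7) in auto)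
  also have "\<dots> = (\<Sum>X\<in>P. of_bool (j \<in> g ` X))"
  proof (rule sum.cong[OF refl])
    fix X assume X: "X \<in> P"
    show "card {x\<in>X. g x = j} = of_bool (j \<in> g ` X)"
    proof (cases "j \<in> g ` X")
      case True
      then obtain x where x: "x \<in> X" "g x = j" by blast
      then have "{x\<in>X. g x = j} = {x}" using inj[OF X] by (auto simp: inj_on_def)
      then show ?thesis using True by simp
    next
      case False
      then have empty: "{x\<in>X. g x = j} = {}" by blast
      show ?thesis unfolding empty using False by simp
    qed
  qed
  also have "\<dots> = card {X\<in>P. j \<in> g ` X}" by (rule card_filter_sum[OF PD(6), symmetric])
  finally show ?thesis .
qed

lemma set_family_of_labelling:
  assumes m: "odd m" and P: "P \<in> set_partitions_mn m n"
    and even: "\<And>p. p \<in> young (m * n) g \<inter> block_stabilizer (m * n) P \<Longrightarrow> sign p = 1"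
  shows "\<exists>F. set_family m n F \<and>
    (\<forall>j. card {X\<in>F. Suc j \<in> X} = card {x\<in>{1..m * n}. g x = j})"
proof -
  note PD = set_partitions_mnD[OF P]
  note inj = inj_on_block[OF P _ even]
  \<comment> \<open>Labels are column indices counted from 0, whereas members of a set family
    consist of positive integers.\<close>
  define G where "G X = Suc ` g ` X" for X
  have injG: "inj_on G P"
  proof (rule inj_onI, rule ccontr)
    fix X Y assume XY: "X \<in> P" "Y \<in> P" "G X = G Y" "X \<noteq> Y"
    have "g ` X = g ` Y" using XY(3) inj_image_eq_iff[OF inj_Suc] by (simp add: G_def)
    from exists_block_swap[OF P XY(1,2,4) inj[OF XY(1)] inj[OF XY(2)] this]
    obtain q where "q \<in> young (m * n) g \<inter> block_stabilizer (m * n) P" "sign q = (-1) ^ m"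
      by blast
    moreover from this have "sign q = 1" by (intro even)
    ultimately show False using m by simp
  qed
  have "set_family m n (G ` P)"
  proof -
    have "card (G X) = m" if "X \<in> P" for X
      using card_image[OF inj[OF that]] PD(3)[OF that] by (simp add: G_def card_image)
    moreover have "finite (G X)" "G X \<subseteq> {1..}" if "X \<in> P" for X
      using PD(5)[OF that] by (auto simp: G_def)
    moreover have "finite (G ` P)" "card (G ` P) = n" using PD(2,6) card_image[OF injG] by simp_all
    ultimately show ?thesis unfolding set_family_def by blast
  qed
  moreover have "card {Z\<in>G ` P. Suc j \<in> Z} = card {x\<in>{1..m * n}. g x = j}" for j
  proof -
    have "{Z\<in>G ` P. Suc j \<in> Z} = G ` {X\<in>P. j \<in> g ` X}" by (auto simp: G_def)
    then have "card {Z\<in>G ` P. Suc j \<in> Z} = card {X\<in>P. j \<in> g ` X}"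
      using card_image[OF inj_on_subset[OF injG]] by (metis (no_types, lifting) mem_Collect_eq subsetI)
    then show ?thesis using card_label_eq[OF P inj] by simp
  qed
  ultimately show ?thesis by blast
qed

text \<open>The points enumerate the disjoint union of the sets; a block collects the copies
  belonging to one index, and the label is the original element. Indexing allows repeated sets, as
  needed for the rectangle with its \<open>n\<close> copies of \<open>{..<m}\<close>.\<close>

lemma labelling_of_sets:
  fixes A :: "'a \<Rightarrow> nat set"
  assumes J: "finite J" "card J = n" and A: "\<And>i. i \<in> J \<Longrightarrow> finite (A i)" "\<And>i. i \<in> J \<Longrightarrow> card (A i) = m"
    and m: "1 \<le> m"
  shows "\<exists>P B g. P \<in> set_partitions_mn m n \<and> bij_betw B J P \<and>
    (\<forall>i\<in>J. inj_on g (B i) \<and> g ` B i = A i) \<and>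
    (\<forall>j. card {x\<in>{1..m * n}. g x = j} = card {i\<in>J. j \<in> A i})"
proof -
  define I where "I = Sigma J A"
  have finI: "finite I" unfolding I_def using J(1) A(1) by blast
  have cardI: "card I = m * n"
    unfolding I_def using J A by (simp add: card_SigmaI)
  obtain h where h: "bij_betw h I {1..m * n}"
    using ex_bij_betw_nat_finite_1[OF finI] bij_betw_inv cardI by metis
  have hinj: "inj_on h I" using h by (rule bij_betw_imp_inj_on)
  define B where "B i = h ` ({i} \<times> A i)" for i
  define g where "g x = snd (the_inv_into I h x)" for x
  have sub: "{i} \<times> A i \<subseteq> I" if "i \<in> J" for i using that by (auto simp: I_def)
  have gh: "g (h (i, a)) = a" if "i \<in> J" "a \<in> A i" for i a
    using the_inv_into_f_f[OF hinj, of "(i, a)"] that by (simp add: g_def I_def)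
  have gB: "inj_on g (B i)" "g ` B i = A i" if "i \<in> J" for i
    using gh that by (auto simp: B_def inj_on_def image_iff)
  have cB: "card (B i) = m" if "i \<in> J" for i
    using card_image[OF gB(1)[OF that]] gB(2)[OF that] A(2)[OF that] by simp
  have disjB: "B i \<inter> B j = {}" if "i \<in> J" "j \<in> J" "i \<noteq> j" for i j
    unfolding B_def using inj_on_image_Int[OF hinj sub[OF that(1)] sub[OF that(2)]] that(3) by auto
  have neB: "B i \<noteq> {}" if "i \<in> J" for i using cB[OF that] m by auto
  have injB: "inj_on B J" using disjB neB by (metis inf.idem inj_onI)
  have "partition_on {1..m * n} (B ` J)"
  proof (rule partition_onI)
    have "\<Union> (B ` J) = h ` I" by (auto simp: B_def I_def)
    then show "\<Union> (B ` J) = {1..m * n}" using bij_betw_imp_surj_on[OF h] by simp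
    show "disjnt p q" if "p \<in> B ` J" "q \<in> B ` J" "p \<noteq> q" for p q
      using that disjB by (auto simp: disjnt_def)
    show "{} \<notin> B ` J" using neB by auto
  qed
  then have P: "B ` J \<in> set_partitions_mn m n"
    using card_image[OF injB] J(2) cB by (auto simp: set_partitions_mn_def)
  have "card {x\<in>{1..m * n}. g x = j} = card {i\<in>J. j \<in> A i}" for j
  proof -
    have "card {x\<in>{1..m * n}. g x = j} = card {X\<in>B ` J. j \<in> g ` X}"
      by (rule card_label_eq[OF P]) (use gB in auto)
    also have "{X\<in>B ` J. j \<in> g ` X} = B ` {i\<in>J. j \<in> A i}" using gB(2) by auto
    also have "card \<dots> = card {i\<in>J. j \<in> A i}"
      by (rule card_image) (use injB in \<open>auto simp: inj_on_def\<close>)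
    finally show ?thesis .
  qed
  then show ?thesis using P injB gB by (intro exI[of _ "B ` J"] exI[of _ B] exI[of _ g]) (auto simp: bij_betw_def)
qed

section \<open>Dominance\<close>

lemma nth_le_largest_part: "i < length lam \<Longrightarrow> lam ! i \<le> largest_part lam"
  by (simp add: largest_part_def)

lemma conj_part_eq_0: "largest_part lam \<le> j \<Longrightarrow> conj_part lam (Suc j) = 0"
proof -
  assume "largest_part lam \<le> j"
  then have "{i. i < length lam \<and> Suc j \<le> lam ! i} = {}"
    using nth_le_largest_part[of _ lam] by fastforce
  then show ?thesis by (simp only: conj_part_def card.empty)
qed

text \<open>Counts the cells of the first \<open>k\<close> rows by columns. Dominance thereby
  becomes a statement about column lengths in which their order is irrelevant.\<close>

lemma sum_list_take_conj:
  assumes lam: "is_partition lam" and a: "largest_part lam \<le> a"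
  shows "sum_list (take k lam) = (\<Sum>j<a. min k (conj_part lam (Suc j)))"
proof -
  let ?l = "min k (length lam)"
  have "sum_list (take k lam) = (\<Sum>i<?l. lam ! i)"
    by (simp add: sum_list_sum_nth atLeast0LessThan min.commute)
  also have "\<dots> = (\<Sum>i<?l. \<Sum>j<a. of_bool (j < lam ! i))"
  proof (rule sum.cong[OF refl])
    fix i assume "i \<in> {..<?l}"
    then have "lam ! i \<le> a" using nth_le_largest_part[of i lam] a by simp
    then have "{j\<in>{..<a}. j < lam ! i} = {..<lam ! i}" by auto
    then show "lam ! i = (\<Sum>j<a. of_bool (j < lam ! i))"
      using card_filter_sum[of "{..<a}" "\<lambda>j. j < lam ! i"] by simp
  qed
  also have "\<dots> = (\<Sum>j<a. \<Sum>i<?l. of_bool (j < lam ! i))" by (rule sum.swap)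
  also have "\<dots> = (\<Sum>j<a. min k (conj_part lam (Suc j)))"
  proof (rule sum.cong[OF refl])
    fix j
    have "{i\<in>{..<?l}. j < lam ! i} = {..<min k (conj_part lam (Suc j))}"
      by (auto simp: less_conj_part_iff[OF lam])
    then show "(\<Sum>i<?l. of_bool (j < lam ! i)) = min k (conj_part lam (Suc j))"
      using card_filter_sum[of "{..<?l}" "\<lambda>i. j < lam ! i"] by simp
  qed
  finally show ?thesis .
qed

lemma sum_list_take_labels:
  assumes lam: "is_partition lam"
    and size: "\<And>j. card {x\<in>{1..r::nat}. g x = j} = conj_part lam (Suc j)"
    and S: "finite S" "g ` {1..r} \<subseteq> S"
  shows "sum_list (take k lam) = (\<Sum>j\<in>S. min k (card {x\<in>{1..r}. g x = j}))"
proof -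
  obtain N where N: "S \<subseteq> {..<N}" using finite_nat_bounded[OF S(1)] by blast
  have "sum_list (take k lam) = (\<Sum>j<max N (largest_part lam). min k (card {x\<in>{1..r}. g x = j}))"
    using sum_list_take_conj[OF lam, of "max N (largest_part lam)"] by (simp only: size)
  also have "\<dots> = (\<Sum>j\<in>S. min k (card {x\<in>{1..r}. g x = j}))"
  proof (rule sum.mono_neutral_right)
    show "S \<subseteq> {..<max N (largest_part lam)}" using N by auto
    show "\<forall>j\<in>{..<max N (largest_part lam)} - S. min k (card {x\<in>{1..r}. g x = j}) = 0"
    proof
      fix j assume "j \<in> {..<max N (largest_part lam)} - S"
      then have "{x\<in>{1..r}. g x = j} = {}" using S(2) by blast
      then show "min k (card {x\<in>{1..r}. g x = j}) = 0" by (simp only: card.empty min_0R)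
    qed
  qed simp
  finally show ?thesis .
qed

lemma sum_card_labels:
  assumes "finite S" "g ` {1..r::nat} \<subseteq> S"
  shows "(\<Sum>j\<in>S. card {x\<in>{1..r}. g x = j}) = r"
  using sum.group[of "{1..r}" S g "\<lambda>_. 1 :: nat"] assms by simp

text \<open>Parts are recovered as differences of prefix sums; their positivity keeps the lengths
  from differing.\<close>

lemma partition_prefix_eq:
  assumes lam: "is_partition lam" and mu: "is_partition mu"
    and eq: "\<And>k. sum_list (take k lam) = sum_list (take k mu)"
  shows "lam = mu"
proof -
  have len: "length b \<le> length a"
    if b: "is_partition b" and e: "\<And>k. sum_list (take k a) = sum_list (take k b)" for a b
  proof (rule ccontr)
    assume "\<not> ?thesis"
    then have l: "length a < length b" by simp
    have "sum_list (take (length a) b) = sum_list (take (Suc (length a)) b)"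
      using e[of "length a"] e[of "Suc (length a)"] by simp
    then have "b ! length a = 0" using l by (simp add: take_Suc_conv_app_nth)
    then show False using b l nth_mem[OF l] unfolding is_partition_def by force
  qed
  have l: "length lam = length mu" using len[OF lam, of mu] len[OF mu, of lam] eq by simp
  show ?thesis
  proof (rule nth_equalityI[OF l])
    fix i assume i: "i < length lam"
    then show "lam ! i = mu ! i"
      using eq[of i] eq[of "Suc i"] l by (simp add: take_Suc_conv_app_nth)
  qed
qed

lemma strictly_dominated_trans:
  assumes "is_partition lam" "is_partition mu" and nu: "dominated nu mu" and mu: "strictly_dominated mu lam"
  shows "strictly_dominated nu lam"
proof -
  have "sum_list nu = sum_list lam" using nu mu by (simp add: strictly_dominated_def dominated_def)
  moreover have "sum_list (take k nu) \<le> sum_list (take k lam)" for k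
    using nu mu order_trans unfolding strictly_dominated_def dominated_def by blast
  ultimately have "dominated nu lam" by (simp add: dominated_def)
  moreover have "nu \<noteq> lam"
  proof
    assume "nu = lam"
    then have "mu = lam"
      using assms by (intro partition_prefix_eq) (auto simp: strictly_dominated_def dominated_def intro: antisym)
    then show False using mu by (simp add: strictly_dominated_def)
  qed
  ultimately show ?thesis by (simp add: strictly_dominated_def)
qed

lemma length_le_sum_list: "is_partition lam \<Longrightarrow> length lam \<le> sum_list lam"
  by (induction lam) (auto simp: is_partition_def)

text \<open>Provides a natural number that drops strictly along the dominance order, for the descent
  to minimal types.\<close>

lemma strictly_dominated_measure:
  assumes lam: "is_partition lam" and mu: "is_partition mu" and dom: "strictly_dominated mu lam"
  shows "(\<Sum>k\<le>sum_list lam. sum_list (take k mu)) < (\<Sum>k\<le>sum_list lam. sum_list (take k lam))"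
proof (rule sum_strict_mono_ex1)
  have le: "sum_list (take k mu) \<le> sum_list (take k lam)" for k
    using dom by (simp add: strictly_dominated_def dominated_def)
  have s: "sum_list mu = sum_list lam" using dom by (simp add: strictly_dominated_def dominated_def)
  show "\<forall>k\<in>{..sum_list lam}. sum_list (take k mu) \<le> sum_list (take k lam)" using le by simp
  obtain k where k: "sum_list (take k mu) \<noteq> sum_list (take k lam)"
    using partition_prefix_eq[OF mu lam] dom unfolding strictly_dominated_def by blast
  \<comment> \<open>Positive parts bound the length by the sum, so beyond this index both prefixes
    are complete and equal in sum.\<close>
  have "k \<le> sum_list lam"
    using k length_le_sum_list[OF lam] length_le_sum_list[OF mu] s by (cases "k \<le> sum_list lam") auto
  then show "\<exists>k\<in>{..sum_list lam}. sum_list (take k mu) < sum_list (take k lam)"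
    using k le[of k] by (intro bexI[of _ k]) auto
qed simp

lemma exists_minimal_below:
  assumes "is_partition lam" "Q lam"
  shows "\<exists>mu. is_partition mu \<and> Q mu \<and> dominated mu lam \<and>
    (\<forall>nu. is_partition nu \<longrightarrow> strictly_dominated nu mu \<longrightarrow> \<not> Q nu)"
  using assms
proof (induction "\<Sum>k\<le>sum_list lam. sum_list (take k lam)" arbitrary: lam rule: less_induct)
  case less
  show ?case
  proof (cases "\<exists>nu. is_partition nu \<and> strictly_dominated nu lam \<and> Q nu")
    case True
    then obtain nu where nu: "is_partition nu" "strictly_dominated nu lam" "Q nu" by blast
    have "sum_list nu = sum_list lam" using nu(2) by (simp add: strictly_dominated_def dominated_def)
    then obtain mu where mu: "is_partition mu" "Q mu" "dominated mu nu"
        "\<forall>nu. is_partition nu \<longrightarrow> strictly_dominated nu mu \<longrightarrow> \<not> Q nu"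
      using less.hyps[of nu] strictly_dominated_measure[OF less.prems(1) nu(1,2)] nu(1,3) by auto
    have "dominated mu lam"
      using strictly_dominated_trans[OF less.prems(1) nu(1) mu(3) nu(2)] by (simp add: strictly_dominated_def)
    then show ?thesis using mu by blast
  next
    case False
    then show ?thesis using less.prems by (intro exI[of _ lam]) (auto simp: dominated_def)
  qed
qed

text \<open>Row \<open>t\<close> of \<open>mu\<close> gets one cell for each column longer than
  \<open>t\<close>, and the number of rows is the longest column \<open>b 0\<close>.\<close>

lemma partition_with_conj:
  assumes anti: "\<And>i j. i \<le> j \<Longrightarrow> b j \<le> b i" and zero: "\<And>j. l \<le> j \<Longrightarrow> b j = (0::nat)"
  shows "\<exists>mu. is_partition mu \<and> (\<forall>j. conj_part mu (Suc j) = b j)"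
proof -
  let ?S = "\<lambda>t. {j. t < b j}"
  have fin: "finite (?S t)" for t
    by (rule finite_subset[of _ "{..<l}"]) (use zero in \<open>auto simp: not_le[symmetric]\<close>)
  have S: "?S t = {..<card (?S t)}" for t
    by (rule downset_eq_lessThan[OF fin]) (use anti in \<open>auto intro: less_le_trans dest: less_imp_le\<close>)
  have Siff: "t < b j \<longleftrightarrow> j < card (?S t)" for t j
    using S[of t] by (metis (no_types, lifting) lessThan_iff mem_Collect_eq)
  define mu where "mu = map (\<lambda>t. card (?S t)) [0..<b 0]"
  have "sorted_wrt (\<ge>) mu"
    unfolding mu_def sorted_wrt_map
    by (rule sorted_wrt_mono_rel[OF _ sorted_wrt_upt]) (auto intro!: card_mono fin)
  moreover have "\<forall>x\<in>set mu. 0 < x" using Siff[of _ 0] by (auto simp: mu_def)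
  moreover have "conj_part mu (Suc j) = b j" for j
  proof -
    have "{t. t < length mu \<and> Suc j \<le> mu ! t} = {..<b j}"
      using anti[of 0 j] by (auto simp: mu_def Suc_le_eq Siff[symmetric])
    then show ?thesis by (simp only: conj_part_def card_lessThan)
  qed
  ultimately show ?thesis by (auto simp: is_partition_def)
qed

text \<open>Moving a point to a class at least as large makes the column lengths more uneven, and by
  concavity of the minimum this lowers the prefix sums of the rows.\<close>

lemma sum_min_labels_move:
  fixes g :: "nat \<Rightarrow> nat"
  assumes x: "x \<in> {1..r::nat}" and j: "j \<noteq> g x" and S: "finite S" "g ` {1..r} \<subseteq> S" "j \<in> S"
    and le: "card {y\<in>{1..r}. g y = g x} \<le> card {y\<in>{1..r}. g y = j}"
  shows "(\<Sum>i\<in>S. min k (card {y\<in>{1..r}. (g(x := j)) y = i})) \<le> (\<Sum>i\<in>S. min k (card {y\<in>{1..r}. g y = i}))"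
    and "\<exists>k. (\<Sum>i\<in>S. min k (card {y\<in>{1..r}. (g(x := j)) y = i})) < (\<Sum>i\<in>S. min k (card {y\<in>{1..r}. g y = i}))"
proof -
  define s where "s i = card {y\<in>{1..r}. g y = i}" for i
  define t where "t i = card {y\<in>{1..r}. (g(x := j)) y = i}" for i
  have "{y\<in>{1..r}. (g(x := j)) y = j} = insert x {y\<in>{1..r}. g y = j}" using x by auto
  then have tj: "t j = Suc (s j)" using j unfolding s_def t_def by simp
  have "{y\<in>{1..r}. g y = g x} = insert x {y\<in>{1..r}. (g(x := j)) y = g x}" using x j by auto
  then have sx: "s (g x) = Suc (t (g x))" using j unfolding s_def t_def by simp
  have other: "t i = s i" if "i \<noteq> j" "i \<noteq> g x" for i
  proof -
    have "{y\<in>{1..r}. (g(x := j)) y = i} = {y\<in>{1..r}. g y = i}" using that by auto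
    then show ?thesis by (simp only: s_def t_def)
  qed
  have gS: "g x \<in> S" using S(2) x by blast
  have split: "(\<Sum>i\<in>S. f i) = f j + f (g x) + (\<Sum>i\<in>S - {j} - {g x}. f i)" for f :: "nat \<Rightarrow> nat"
    using sum.remove[OF S(1,3), of f] sum.remove[of "S - {j}" "g x" f] S(1) gS j by simp
  have rest: "(\<Sum>i\<in>S - {j} - {g x}. min k (t i)) = (\<Sum>i\<in>S - {j} - {g x}. min k (s i))" for k
    by (rule sum.cong[OF refl]) (simp add: other)
  have "s (g x) \<le> s j" using le by (simp add: s_def)
  then have "min k (t j) + min k (t (g x)) \<le> min k (s j) + min k (s (g x))" for k
    unfolding tj sx by auto
  then have "(\<Sum>i\<in>S. min k (t i)) \<le> (\<Sum>i\<in>S. min k (s i))" for k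
    unfolding split[of "\<lambda>i. min k (t i)"] split[of "\<lambda>i. min k (s i)"] rest by (rule add_right_mono)
  then show "(\<Sum>i\<in>S. min k (card {y\<in>{1..r}. (g(x := j)) y = i})) \<le> (\<Sum>i\<in>S. min k (card {y\<in>{1..r}. g y = i}))"
    unfolding s_def t_def .
  \<comment> \<open>At the bound \<open>s (g x)\<close> the minimum cuts off the gain of class
    \<open>j\<close>, while the loss of the old class counts.\<close>
  have "(\<Sum>i\<in>S. min (s (g x)) (t i)) < (\<Sum>i\<in>S. min (s (g x)) (s i))"
    unfolding split[of "\<lambda>i. min (s (g x)) (t i)"] split[of "\<lambda>i. min (s (g x)) (s i)"] rest
    using tj sx \<open>s (g x) \<le> s j\<close> by simp
  then show "\<exists>k. (\<Sum>i\<in>S. min k (card {y\<in>{1..r}. (g(x := j)) y = i})) < (\<Sum>i\<in>S. min k (card {y\<in>{1..r}. g y = i}))"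
    unfolding s_def t_def by blast
qed

section \<open>Constituents of the Foulkes character\<close>

lemma card_column_of:
  assumes lam: "partition_of r lam" and T: "T \<in> tableaux lam"
  shows "card {x\<in>{1..r}. column_of lam T x = j} = conj_part lam (Suc j)"
proof -
  have bij: "bij_betw T (cells lam) {1..r}" using tableau_bij[OF lam T] .
  have inj: "inj_on T (cells lam)" and im: "T ` cells lam = {1..r}"
    using bij by (auto simp: bij_betw_def)
  have col: "column_of lam T (T c) = snd c" if "c \<in> cells lam" for c
    using the_inv_into_f_f[OF inj that] by (simp add: column_of_def)
  have "{x\<in>{1..r}. column_of lam T x = j} = T ` {c\<in>cells lam. snd c = j}"
    unfolding im[symmetric] using col by auto
  then have "card {x\<in>{1..r}. column_of lam T x = j} = card {c\<in>cells lam. snd c = j}"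
    using card_image[OF inj_on_subset[OF inj]] by (metis (no_types, lifting) mem_Collect_eq subsetI)
  also have "{c\<in>cells lam. snd c = j} = (\<lambda>i. (i, j)) ` {..<conj_part lam (Suc j)}"
    using lam by (auto simp: cells_conj_part partition_of_def)
  also have "card \<dots> = conj_part lam (Suc j)" by (subst card_image) (auto simp: inj_on_def)
  finally show ?thesis .
qed

text \<open>Of the tableau only its column labelling is retained; the upper bounds on constituents
  are read off from it.\<close>

lemma labelling_of_foulkes_constituent:
  assumes lam: "partition_of (m * n) lam"
    and nz: "char_inner (m * n) (foulkes_char m n) (irr_char lam) \<noteq> 0"
  shows "\<exists>P\<in>set_partitions_mn m n. \<exists>g.
    (\<forall>j. card {x\<in>{1..m * n}. g x = j} = conj_part lam (Suc j)) \<and>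
    (\<forall>p\<in>young (m * n) g \<inter> block_stabilizer (m * n) P. sign p = 1)"
proof -
  obtain P where P: "P \<in> set_partitions_mn m n"
      "\<not> invariants lam (block_stabilizer (m * n) P) \<subseteq> {0}"
    using foulkes_multiplicity_zero[OF lam] nz by metis
  obtain T where T: "T \<in> tableaux lam"
      "\<forall>p\<in>young (m * n) (column_of lam T) \<inter> block_stabilizer (m * n) P. sign p = 1"
    using invariants_nonzero_imp_even_tableau[OF lam perm_subgroup_block_stabilizer P(2)] by metis
  show ?thesis
    by (intro bexI[OF _ P(1)] exI[of _ "column_of lam T"] conjI allI T(2) card_column_of[OF lam T(1)])
qed

section \<open>Permutations preserving both labels and blocks\<close>

lemma young_fixing_blocks_eq_id:
  assumes P: "P \<in> set_partitions_mn m n" and inj: "\<And>X. X \<in> P \<Longrightarrow> inj_on g X"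
    and p: "p \<in> young (m * n) g" and fixed: "\<And>X. X \<in> P \<Longrightarrow> p ` X = X"
  shows "p = id"
proof
  fix x
  show "p x = id x"
  proof (cases "x \<in> {1..m * n}")
    case True
    then obtain X where X: "X \<in> P" "x \<in> X" using set_partitions_mnD(8)[OF P] by blast
    then have "p x \<in> X" using fixed by blast
    moreover have "g (p x) = g x" using p True by (simp add: young_def)
    ultimately show ?thesis using inj_onD[OF inj[OF X(1)]] X(2) by simp
  next
    case False
    then show ?thesis using permutes_not_in[OF young_permutes[OF p]] by simp
  qed
qed

lemma young_image_block:
  assumes P: "P \<in> set_partitions_mn m n" and X: "X \<in> P"
    and p: "p \<in> young (m * n) g" "p \<in> block_stabilizer (m * n) P"
  shows "p ` X \<in> P" "g ` p ` X = g ` X"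
proof -
  show "p ` X \<in> P" using p(2) X by (auto simp: block_stabilizer_def)
  have "g (p x) = g x" if "x \<in> X" for x
    using p(1) that set_partitions_mnD(4)[OF P X] unfolding young_def by blast
  then show "g ` p ` X = g ` X" by (simp add: image_image)
qed

text \<open>For even \<open>m\<close>, interchanging two blocks along the columns is an even permutation, so undoing
  the action on blocks one block at a time does not change the sign.\<close>

lemma sign_block_permutation:
  assumes m: "even m" and P: "P \<in> set_partitions_mn m n"
    and inj: "\<And>X. X \<in> P \<Longrightarrow> inj_on g X" and im: "\<And>X. X \<in> P \<Longrightarrow> g ` X = A"
    and p: "p \<in> young (m * n) g" "p \<in> block_stabilizer (m * n) P"
  shows "sign p = 1"
  using p
proof (induction "card {X\<in>P. p ` X \<noteq> X}" arbitrary: p rule: less_induct)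
  case less
  show ?case
  proof (cases "\<forall>X\<in>P. p ` X = X")
    case True
    then have "p = id" using young_fixing_blocks_eq_id[OF P inj less.prems(1)] by blast
    then show ?thesis by simp
  next
    case False
    then obtain X where X: "X \<in> P" "p ` X \<noteq> X" by blast
    have pX: "p ` X \<in> P" using young_image_block(1)[OF P X(1) less.prems] .
    have "g ` X = g ` p ` X" using im X(1) pX by metis
    from exists_block_swap[OF P X(1) pX X(2)[symmetric] inj[OF X(1)] inj[OF pX] this]
    obtain q where q: "q \<in> young (m * n) g" "q \<in> block_stabilizer (m * n) P"
        "q ` X = p ` X" "q ` p ` X = X" "\<forall>Z\<in>P. Z \<noteq> X \<longrightarrow> Z \<noteq> p ` X \<longrightarrow> q ` Z = Z" "sign q = (-1) ^ m"
      by (elim exE conjE)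
    have qp: "q \<circ> p \<in> young (m * n) g" "q \<circ> p \<in> block_stabilizer (m * n) P"
      using young_comp[OF q(1) less.prems(1)]
        perm_subgroupD(3)[OF perm_subgroup_block_stabilizer q(2) less.prems(2)] by auto
    have injp: "inj p" using permutes_inj[OF young_permutes[OF less.prems(1)]] .
    \<comment> \<open>Composing with \<open>q\<close> makes \<open>X\<close> fixed and loses no
      fixed block: \<open>p\<close> moves both \<open>X\<close> and its image, so \<open>q\<close>
      leaves every block fixed by \<open>p\<close> in place.\<close>
    have "(q \<circ> p) ` Z = Z" if Z: "Z \<in> P" "p ` Z = Z" for Z
    proof -
      have "Z \<noteq> X" using Z X(2) by metis
      moreover from this have "Z \<noteq> p ` X" using Z(2) inj_image_eq_iff[OF injp, of Z X] by metis
      ultimately show ?thesis using q(5) Z by (metis image_comp)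
    qed
    moreover have "(q \<circ> p) ` X = X" using q(4) by (metis image_comp)
    ultimately have "{Z\<in>P. (q \<circ> p) ` Z \<noteq> Z} \<subset> {Z\<in>P. p ` Z \<noteq> Z}" using X by blast
    then have "card {Z\<in>P. (q \<circ> p) ` Z \<noteq> Z} < card {Z\<in>P. p ` Z \<noteq> Z}"
      using set_partitions_mnD(6)[OF P] by (intro psubset_card_mono) auto
    then have "sign (q \<circ> p) = 1" using less.hyps qp by blast
    moreover have "sign (q \<circ> p) = sign q * sign p"
      by (rule sign_compose) (use q(1) less.prems(1) in \<open>auto dest: young_permutes intro: permutation_interval\<close>)
    ultimately show ?thesis using q(6) m by simp
  qed
qed

section \<open>The rectangular shape\<close>

lemma card_label_le:
  assumes P: "P \<in> set_partitions_mn m n" and inj: "\<And>X. X \<in> P \<Longrightarrow> inj_on g X"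
  shows "card {x\<in>{1..m * n}. g x = j} \<le> n"
proof -
  have "card {X\<in>P. j \<in> g ` X} \<le> card P" using set_partitions_mnD(6)[OF P] by (intro card_mono) auto
  then show ?thesis using card_label_eq[OF P inj, of j] set_partitions_mnD(2)[OF P] by simp
qed

lemma conj_part_replicate: "conj_part (replicate n m) (Suc j) = (if j < m then n else 0)"
proof -
  have "{i. i < length (replicate n m) \<and> Suc j \<le> replicate n m ! i} = (if j < m then {..<n} else {})"
    by auto
  then show ?thesis by (simp add: conj_part_def)
qed

lemma partition_of_replicate: "1 \<le> m \<Longrightarrow> partition_of (m * n) (replicate n m)"
  by (auto simp: partition_of_def is_partition_def sum_list_replicate sorted_wrt_iff_nth_less)

lemma foulkes_constituent_rectangle:
  assumes "1 \<le> m" "even m"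
  shows "1 \<le> char_inner (m * n) (foulkes_char m n) (irr_char (replicate n m))"
proof -
  obtain P B and g :: "nat \<Rightarrow> nat" where P: "P \<in> set_partitions_mn m n" "bij_betw B {..<n} P"
      "\<forall>i\<in>{..<n}. inj_on g (B i) \<and> g ` B i = {..<m}"
      "\<forall>j. card {x\<in>{1..m * n}. g x = j} = card {i\<in>{..<n}. j \<in> {..<m}}"
    using labelling_of_sets[of "{..<n}" n "\<lambda>_. {..<m}" m] assms(1) by auto
  have injg: "inj_on g X" and img: "g ` X = {..<m}" if "X \<in> P" for X
    using that P(2,3) unfolding bij_betw_def by blast+
  have size: "card {x\<in>{1..m * n}. g x = j} = (if j < m then n else 0)" for j
    using P(4) by simp
  show ?thesis
  proof (rule foulkes_constituent_of_labelling[OF partition_of_replicate[OF assms(1)] P(1)])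
    show "card {x\<in>{1..m * n}. g x = j} = conj_part (replicate n m) (Suc j)" for j
      by (simp only: size conj_part_replicate)
    show "sign p = 1" if "p \<in> young (m * n) g \<inter> block_stabilizer (m * n) P" for p
      by (rule sign_block_permutation[OF assms(2) P(1) injg img]) (use that in simp_all)
    show "\<exists>p\<in>young (m * n) (g(x := j)) \<inter> block_stabilizer (m * n) P. sign p \<noteq> 1"
      if x: "x \<in> {1..m * n}" and j: "j < g x" for x j
    \<comment> \<open>Column \<open>j\<close> already holds \<open>n\<close> points, one from each
      block. With the moved point it holds \<open>n + 1\<close>, so the changed labelling cannot be
      injective on every block.\<close>
    proof (rule ccontr)
      assume "\<not> ?thesis"
      then have inj: "inj_on (g(x := j)) X" if "X \<in> P" for X
        using inj_on_block[OF P(1) that] by blast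
      have "card {y\<in>{1..m * n}. (g(x := j)) y = j} \<le> n" by (rule card_label_le[OF P(1) inj])
      moreover have "{y\<in>{1..m * n}. (g(x := j)) y = j} = insert x {y\<in>{1..m * n}. g y = j}" using x by auto
      moreover have "card (insert x {y\<in>{1..m * n}. g y = j}) = Suc (card {y\<in>{1..m * n}. g y = j})"
        using j by simp
      moreover have "j < m"
      proof -
        obtain X where "X \<in> P" "x \<in> X" using x set_partitions_mnD(8)[OF P(1)] by blast
        then have "g x < m" using img by blast
        then show ?thesis using j by simp
      qed
      ultimately show False using size[of j] by simp
    qed
  qed
qed

text \<open>Injectivity on blocks bounds all columns by \<open>n\<close>, and the rectangle is the
  least shape in dominance under this bound.\<close>

lemma rectangle_dominated:
  assumes lam: "partition_of (m * n) lam"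
    and nz: "char_inner (m * n) (foulkes_char m n) (irr_char lam) \<noteq> 0"
  shows "dominated (replicate n m) lam"
proof -
  from labelling_of_foulkes_constituent[OF lam nz]
  obtain P g where P: "P \<in> set_partitions_mn m n"
      "\<forall>j. card {x\<in>{1..m * n}. g x = j} = conj_part lam (Suc j)"
      "\<forall>p\<in>young (m * n) g \<inter> block_stabilizer (m * n) P. sign p = 1"
    by (elim bexE exE conjE)
  note size = spec[OF P(2)] and even = bspec[OF P(3)]
  have le: "card {x\<in>{1..m * n}. g x = j} \<le> n" for j
    by (rule card_label_le[OF P(1) inj_on_block[OF P(1) _ even]])
  let ?S = "g ` {1..m * n}"
  have part: "is_partition lam" "sum_list lam = m * n" using lam by (auto simp: partition_of_def)
  have tot: "(\<Sum>j\<in>?S. card {x\<in>{1..m * n}. g x = j}) = m * n" by (rule sum_card_labels) auto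
  have "sum_list (take k (replicate n m)) \<le> sum_list (take k lam)" for k
  proof -
    have lamk: "sum_list (take k lam) = (\<Sum>j\<in>?S. min k (card {x\<in>{1..m * n}. g x = j}))"
      by (rule sum_list_take_labels[OF part(1) size]) auto
    show ?thesis
    proof (cases "n \<le> k")
      case True
      then have "min k (card {x\<in>{1..m * n}. g x = j}) = card {x\<in>{1..m * n}. g x = j}" for j
        using le[of j] by simp
      then have "sum_list (take k lam) = m * n" unfolding lamk using tot by simp
      then show ?thesis using True by (simp add: sum_list_replicate)
    next
      case False
      \<comment> \<open>If the size is at most \<open>k\<close> this compares \<open>k\<close> with
        \<open>n\<close>; otherwise the minimum is \<open>k\<close> and the size is compared with
        \<open>n\<close>.\<close>
      have "k * card {x\<in>{1..m * n}. g x = j} \<le> n * min k (card {x\<in>{1..m * n}. g x = j})" for j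
        using le[of j] False by (auto simp: min_def mult.commute[of n k] intro: mult_le_mono)
      then have "(\<Sum>j\<in>?S. k * card {x\<in>{1..m * n}. g x = j}) \<le>
          (\<Sum>j\<in>?S. n * min k (card {x\<in>{1..m * n}. g x = j}))" by (intro sum_mono)
      then have "n * (k * m) \<le> n * sum_list (take k lam)"
        unfolding lamk sum_distrib_left[symmetric] tot by (simp add: mult_ac)
      then have "k * m \<le> sum_list (take k lam)" using False by simp
      then show ?thesis using False by (simp add: sum_list_replicate)
    qed
  qed
  then show ?thesis using part(2) by (simp add: dominated_def sum_list_replicate mult.commute)
qed

lemma dominated_antisym:
  assumes "is_partition lam" "is_partition mu" "dominated lam mu" "dominated mu lam"
  shows "lam = mu"
  using assms by (intro partition_prefix_eq) (auto simp: dominated_def intro: antisym)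

section \<open>Types of set families as shapes of constituents\<close>

lemma labelling_of_set_family:
  assumes F: "set_family m n F" "has_type F lam" and lam: "partition_of (m * n) lam" and m: "1 \<le> m"
  shows "\<exists>P g. P \<in> set_partitions_mn m n \<and>
    (\<forall>j. card {x\<in>{1..m * n}. g x = j} = conj_part lam (Suc j)) \<and>
    (\<forall>p\<in>young (m * n) g \<inter> block_stabilizer (m * n) P. sign p = 1)"
proof -
  let ?A = "\<lambda>X. (\<lambda>i. i - 1) ` (X :: nat set)"
  have fam: "finite F" "card F = n" "\<And>X. X \<in> F \<Longrightarrow> finite X" "\<And>X. X \<in> F \<Longrightarrow> card X = m"
      "\<And>X. X \<in> F \<Longrightarrow> X \<subseteq> {1..}"
    using F(1) by (auto simp: set_family_def)
  have injA: "inj_on (\<lambda>i::nat. i - 1) {1..}" by (auto simp: inj_on_def)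
  have SucA: "Suc ` ?A X = X" if "X \<in> F" for X
  proof -
    have "(\<lambda>i. Suc (i - 1)) ` X = (\<lambda>i. i) ` X"
      by (rule image_cong[OF refl]) (use fam(5)[OF that] in auto)
    then show ?thesis by (simp add: image_image)
  qed
  have memA: "j \<in> ?A X \<longleftrightarrow> Suc j \<in> X" if "X \<in> F" for X j
    using inj_image_mem_iff[OF inj_Suc, of j "?A X"] SucA[OF that] by simp
  have cA: "card (?A X) = m" if "X \<in> F" for X
    using card_image[OF inj_on_subset[OF injA fam(5)[OF that]]] fam(4)[OF that] by simp
  obtain P B g where P: "P \<in> set_partitions_mn m n" "bij_betw B F P"
      "\<forall>X\<in>F. inj_on g (B X) \<and> g ` B X = ?A X"
      "\<forall>j. card {x\<in>{1..m * n}. g x = j} = card {X\<in>F. j \<in> ?A X}"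
    using labelling_of_sets[OF fam(1,2), of ?A m] fam(3) cA m by auto
  have inj: "inj_on g X" if "X \<in> P" for X using that P(2,3) unfolding bij_betw_def by blast
  have sep: "X = Y" if XY: "X \<in> P" "Y \<in> P" "g ` X = g ` Y" for X Y
  proof -
    obtain X' Y' where "X' \<in> F" "Y' \<in> F" "X = B X'" "Y = B Y'" using XY P(2) unfolding bij_betw_def by blast
    moreover from this have "?A X' = ?A Y'" using P(3) XY(3) by simp
    ultimately show ?thesis using SucA by metis
  qed
  have size0: "card {x\<in>{1..m * n}. g x = j} = conj_part lam (Suc j)" if "j < largest_part lam" for j
  proof -
    have "{X\<in>F. j \<in> ?A X} = {X\<in>F. Suc j \<in> X}" using memA by blast
    then have "card {x\<in>{1..m * n}. g x = j} = card {X\<in>F. Suc j \<in> X}" using P(4) by simp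
    also have "\<dots> = conj_part lam (Suc j)" using F(2) that by (simp add: has_type_def)
    finally show ?thesis .
  qed
  \<comment> \<open>\<open>has_type\<close> constrains only elements up to the largest part; the
    corresponding classes already account for all \<open>m * n\<close> points, so no label lies
    beyond.\<close>
  have "g x < largest_part lam" if x: "x \<in> {1..m * n}" for x
  proof (rule ccontr)
    assume nl: "\<not> ?thesis"
    let ?L = "{y\<in>{1..m * n}. g y < largest_part lam}"
    have "m * n = sum_list (take (length lam) lam)" using lam by (simp add: partition_of_def)
    also have "\<dots> = (\<Sum>j<largest_part lam. min (length lam) (conj_part lam (Suc j)))"
      using lam by (intro sum_list_take_conj) (auto simp: partition_of_def)
    also have "\<dots> \<le> (\<Sum>j<largest_part lam. card {y\<in>{1..m * n}. g y = j})"
    proof (rule sum_mono)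
      fix j assume "j \<in> {..<largest_part lam}"
      then show "min (length lam) (conj_part lam (Suc j)) \<le> card {y\<in>{1..m * n}. g y = j}"
        using size0[of j] by (simp only: lessThan_iff min.cobounded2)
    qed
    also have "\<dots> = (\<Sum>j<largest_part lam. card {y\<in>?L. g y = j})"
      by (intro sum.cong refl arg_cong[of _ _ card]) auto
    also have "\<dots> = card ?L"
      using sum.group[of ?L "{..<largest_part lam}" g "\<lambda>_. 1 :: nat"] by (simp add: image_subset_iff)
    also have "\<dots> < card {1..m * n}" 
    proof (rule psubset_card_mono)
      have "x \<notin> ?L" using nl by blast
      then show "?L \<subset> {1..m * n}" using x by blast
    qed simp
    finally show False by simp
  qed
  then have "card {x\<in>{1..m * n}. g x = j} = 0" if "largest_part lam \<le> j" for j
    using that by (metis (mono_tags, lifting) card.empty empty_Collect_eq not_le)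
  then have size: "card {x\<in>{1..m * n}. g x = j} = conj_part lam (Suc j)" for j
    using size0[of j] conj_part_eq_0[of lam j] by (cases "j < largest_part lam") auto
  \<comment> \<open>The sets of the family are distinct, so a block is determined by its set of
    labels. Hence \<open>p\<close> fixes every block, and then every point.\<close>
  have "sign p = 1" if p: "p \<in> young (m * n) g" "p \<in> block_stabilizer (m * n) P" for p
  proof -
    have "p ` X = X" if "X \<in> P" for X
      using young_image_block[OF P(1) that p] sep that by blast
    then have "p = id" using young_fixing_blocks_eq_id[OF P(1) inj p(1)] by blast
    then show ?thesis by simp
  qed
  then show ?thesis using P(1) size by blast
qed

text \<open>Class sizes need not decrease with the label, for instance after one label has been
  changed, so the classes are renumbered to obtain a type. The formula for its prefix sums does not
  see the numbering.\<close>

lemma set_family_type_of_labelling: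
  assumes m: "odd m" and P: "P \<in> set_partitions_mn m n"
    and even: "\<And>p. p \<in> young (m * n) g \<inter> block_stabilizer (m * n) P \<Longrightarrow> sign p = 1"
  shows "\<exists>F mu. is_partition mu \<and> set_family m n F \<and> has_type F mu \<and>
    (\<forall>k. sum_list (take k mu) = (\<Sum>j\<in>g ` {1..m * n}. min k (card {x\<in>{1..m * n}. g x = j})))"
proof -
  let ?r = "m * n"
  let ?I = "g ` {1..?r}"
  let ?s = "\<lambda>i. card {x\<in>{1..?r}. g x = i}"
  obtain \<sigma> where \<sigma>: "inj_on \<sigma> ?I" "\<sigma> ` ?I = {..<card ?I}"
      "\<forall>a\<in>?I. \<forall>b\<in>?I. \<sigma> a \<le> \<sigma> b \<longrightarrow> ?s b \<le> ?s a"
    using sort_labels[of ?I ?s] by blast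
  define h where "h = \<sigma> \<circ> g"
  define b where "b j = card {x\<in>{1..?r}. h x = j}" for j
  have him: "h ` {1..?r} = {..<card ?I}" using \<sigma>(2) by (simp add: h_def image_comp)
  have ker: "g x = g y \<longleftrightarrow> h x = h y" if "x \<in> {1..?r}" "y \<in> {1..?r}" for x y
    using \<sigma>(1) that by (auto simp: h_def inj_on_eq_iff)
  have bs: "b (\<sigma> i) = ?s i" if "i \<in> ?I" for i
  proof -
    obtain z where z: "z \<in> {1..?r}" "i = g z" using \<open>i \<in> ?I\<close> by blast
    have "{x\<in>{1..?r}. h x = \<sigma> i} = {x\<in>{1..?r}. g x = i}"
      using ker[OF _ z(1)] z(2) unfolding h_def by auto
    then show ?thesis by (simp only: b_def)
  qed
  have b0: "b j = 0" if "card ?I \<le> j" for j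
  proof -
    have "h x \<noteq> j" if "x \<in> {1..?r}" for x
      using imageI[OF that, of h] \<open>card ?I \<le> j\<close> unfolding him by auto
    then have "{x\<in>{1..?r}. h x = j} = {}" by blast
    then show ?thesis by (simp only: b_def card.empty)
  qed
  have anti: "b j \<le> b i" if ij: "i \<le> j" for i j
  proof (cases "j < card ?I")
    case True
    then have "i \<in> \<sigma> ` ?I" "j \<in> \<sigma> ` ?I" using \<sigma>(2) ij by simp_all
    then obtain i' j' where ij': "i' \<in> ?I" "j' \<in> ?I" "i = \<sigma> i'" "j = \<sigma> j'" by blast
    have "?s j' \<le> ?s i'" using bspec[OF bspec[OF \<sigma>(3) ij'(1)] ij'(2)] ij ij'(3,4) by simp
    then show ?thesis unfolding ij'(3,4) bs[OF ij'(1)] bs[OF ij'(2)] .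
  next
    case False
    then show ?thesis using b0[of j] by simp
  qed
  obtain mu where mu: "is_partition mu" "\<And>j. conj_part mu (Suc j) = b j"
    using partition_with_conj[of b, OF anti b0] by blast
  have young_h: "young ?r h = young ?r g" using young_kernel_cong[of ?r g h] ker by blast
  have "\<exists>F. set_family m n F \<and> (\<forall>j. card {X\<in>F. Suc j \<in> X} = b j)"
    unfolding b_def by (rule set_family_of_labelling[OF m P]) (unfold young_h, rule even)
  then obtain F where F: "set_family m n F" "\<And>j. card {X\<in>F. Suc j \<in> X} = b j" by blast
  have "has_type F mu"
    unfolding has_type_def
  proof
    fix i assume "i \<in> {1..largest_part mu}"
    then obtain j where "i = Suc j" by (cases i) auto
    then show "card {X\<in>F. i \<in> X} = conj_part mu i" using F(2) mu(2) by simp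
  qed
  moreover have "sum_list (take k mu) = (\<Sum>i\<in>?I. min k (?s i))" for k
  proof -
    have "sum_list (take k mu) = (\<Sum>j\<in>h ` {1..?r}. min k (card {x\<in>{1..?r}. h x = j}))"
      by (rule sum_list_take_labels[OF mu(1)]) (auto simp: mu(2) b_def)
    also have "h ` {1..?r} = \<sigma> ` ?I" by (simp add: h_def image_comp)
    also have "(\<Sum>j\<in>\<sigma> ` ?I. min k (card {x\<in>{1..?r}. h x = j})) = (\<Sum>i\<in>?I. min k (b (\<sigma> i)))"
      by (subst sum.reindex[OF \<sigma>(1)]) (simp add: b_def)
    also have "\<dots> = (\<Sum>i\<in>?I. min k (?s i))" by (rule sum.cong[OF refl]) (simp only: bs)
    finally show ?thesis .
  qed
  ultimately show ?thesis using mu(1) F(1) by blast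
qed

lemma set_family_of_foulkes_constituent:
  assumes m: "odd m" and lam: "partition_of (m * n) lam"
    and nz: "char_inner (m * n) (foulkes_char m n) (irr_char lam) \<noteq> 0"
  shows "\<exists>F. set_family m n F \<and> has_type F lam"
proof -
  from labelling_of_foulkes_constituent[OF lam nz]
  obtain P g where P: "P \<in> set_partitions_mn m n"
      "\<forall>j. card {x\<in>{1..m * n}. g x = j} = conj_part lam (Suc j)"
      "\<forall>p\<in>young (m * n) g \<inter> block_stabilizer (m * n) P. sign p = 1"
    by (elim bexE exE conjE)
  note size = spec[OF P(2)] and even = bspec[OF P(3)]
  have "\<exists>F. set_family m n F \<and> (\<forall>j. card {X\<in>F. Suc j \<in> X} = card {x\<in>{1..m * n}. g x = j})"
    by (rule set_family_of_labelling[OF m P(1)]) (rule even)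
  then obtain F where F: "set_family m n F" "\<And>j. card {X\<in>F. Suc j \<in> X} = conj_part lam (Suc j)"
    unfolding size by blast
  have "has_type F lam"
    unfolding has_type_def
  proof
    fix i assume "i \<in> {1..largest_part lam}"
    then obtain j where "i = Suc j" by (cases i) auto
    then show "card {X\<in>F. i \<in> X} = conj_part lam i" using F(2) by simp
  qed
  then show ?thesis using F(1) by blast
qed

lemma conj_part_antimono: "i \<le> j \<Longrightarrow> conj_part lam j \<le> conj_part lam i"
  unfolding conj_part_def by (intro card_mono) auto

text \<open>Minimality supplies the odd elements required by
  \<open>foulkes_constituent_of_labelling\<close>: without one, the changed labelling would itself
  yield a set family, of strictly smaller type.\<close>

lemma foulkes_constituent_of_minimal_family:
  assumes m: "odd m" and lam: "partition_of (m * n) lam" and min: "minimal_set_family m n F lam"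
  shows "1 \<le> char_inner (m * n) (foulkes_char m n) (irr_char lam)"
proof -
  let ?r = "m * n"
  have "1 \<le> m" using m by (cases m) auto
  have "set_family m n F" "has_type F lam" using min by (simp_all add: minimal_set_family_def)
  from labelling_of_set_family[OF this lam \<open>1 \<le> m\<close>]
  obtain P g where P: "P \<in> set_partitions_mn m n"
      and sizes: "\<forall>j. card {x\<in>{1..?r}. g x = j} = conj_part lam (Suc j)"
      and signs: "\<forall>p\<in>young ?r g \<inter> block_stabilizer ?r P. sign p = 1"
    by (elim exE conjE)
  note size = spec[OF sizes] and even = bspec[OF signs]
  have part: "is_partition lam" "sum_list lam = ?r" using lam by (auto simp: partition_of_def)
  show ?thesis
  proof (rule foulkes_constituent_of_labelling[OF lam P size even])
    show "\<exists>p\<in>young ?r (g(x := j)) \<inter> block_stabilizer ?r P. sign p \<noteq> 1"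
      if x: "x \<in> {1..?r}" and j: "j < g x" for x j
    proof (rule ccontr)
      assume "\<not> ?thesis"
      then have "\<And>p. p \<in> young ?r (g(x := j)) \<inter> block_stabilizer ?r P \<Longrightarrow> sign p = 1" by blast
      from set_family_type_of_labelling[OF m P this]
      obtain G mu where mu: "is_partition mu" "set_family m n G" "has_type G mu"
          "\<And>k. sum_list (take k mu) = (\<Sum>i\<in>(g(x := j)) ` {1..?r}. min k (card {y\<in>{1..?r}. (g(x := j)) y = i}))"
        by blast
      define S where "S = insert j (g ` {1..?r})"
      have S: "finite S" "g ` {1..?r} \<subseteq> S" "j \<in> S" by (auto simp: S_def)
      have muk: "sum_list (take k mu) = (\<Sum>i\<in>S. min k (card {y\<in>{1..?r}. (g(x := j)) y = i}))" for k
        unfolding mu(4)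
      proof (rule sum.mono_neutral_left[OF S(1)])
        show "(g(x := j)) ` {1..?r} \<subseteq> S" by (auto simp: S_def)
        show "\<forall>i\<in>S - (g(x := j)) ` {1..?r}. min k (card {y\<in>{1..?r}. (g(x := j)) y = i}) = 0"
        proof
          fix i assume "i \<in> S - (g(x := j)) ` {1..?r}"
          then have "{y\<in>{1..?r}. (g(x := j)) y = i} = {}" by blast
          then show "min k (card {y\<in>{1..?r}. (g(x := j)) y = i}) = 0" by (simp only: card.empty min_0R)
        qed
      qed
      have lamk: "sum_list (take k lam) = (\<Sum>i\<in>S. min k (card {y\<in>{1..?r}. g y = i}))" for k
        by (rule sum_list_take_labels[OF part(1) size S(1,2)])
      \<comment> \<open>Class sizes are the column lengths of \<open>lam\<close>, so an earlier
        class is at least as large and the move lowers the type.\<close>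
      have "card {y\<in>{1..?r}. g y = g x} \<le> card {y\<in>{1..?r}. g y = j}"
        unfolding size using j by (intro conj_part_antimono) simp
      note move = sum_min_labels_move[OF x less_imp_neq[OF j] S this, folded muk lamk]
      have "sum_list mu = ?r"
      proof -
        \<comment> \<open>The index \<open>length mu + ?r\<close> exceeds neither too few parts nor
          any class size: there the prefix is all of \<open>mu\<close> and each minimum is the full
          class size.\<close>
        have "card {y\<in>{1..?r}. (g(x := j)) y = i} \<le> length mu + ?r" for i
          using card_mono[of "{1..?r}" "{y\<in>{1..?r}. (g(x := j)) y = i}"] by fastforce
        then have "sum_list (take (length mu + ?r) mu) = (\<Sum>i\<in>S. card {y\<in>{1..?r}. (g(x := j)) y = i})"
          unfolding muk by (intro sum.cong refl) (simp add: min_absorb2)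
        also have "\<dots> = ?r" by (rule sum_card_labels[OF S(1)]) (auto simp: S_def)
        finally show ?thesis by simp
      qed
      then have "dominated mu lam" using move(1) part(2) by (simp add: dominated_def)
      moreover have "mu \<noteq> lam" using move(2) by auto
      ultimately have "strictly_dominated mu lam" by (simp add: strictly_dominated_def)
      then show False using min mu(1,2,3) unfolding minimal_set_family_def by blast
    qed
  qed
qed

theorem theorem1p2:
  fixes m n :: nat
  assumes "1 \<le> m" and "1 \<le> n"
  shows "(even m \<longrightarrow>
            (\<forall>lam. partition_of (m * n) lam \<longrightarrow>
               (minimal_constituent (m * n) (foulkes_char m n) lam \<longleftrightarrow> lam = replicate n m)))
       \<and> (odd m \<longrightarrow>
            (\<forall>lam. partition_of (m * n) lam \<longrightarrow>
               (minimal_constituent (m * n) (foulkes_char m n) lam \<longleftrightarrow>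
                  (\<exists>F. minimal_set_family m n F lam))))"
proof (intro conjI impI allI)
  fix lam
  assume m: "even m" and lam: "partition_of (m * n) lam"
  let ?c = "\<lambda>mu. char_inner (m * n) (foulkes_char m n) (irr_char mu)"
  let ?R = "replicate n m"
  note R = partition_of_replicate[OF assms(1), of n]
  have cR: "1 \<le> ?c ?R" using foulkes_constituent_rectangle[OF assms(1) m] .
  show "minimal_constituent (m * n) (foulkes_char m n) lam \<longleftrightarrow> lam = ?R"
  proof
    assume min: "minimal_constituent (m * n) (foulkes_char m n) lam"
    then have "?c lam \<noteq> 0" by (simp add: minimal_constituent_def)
    then have "dominated ?R lam" by (rule rectangle_dominated[OF lam])
    moreover have "\<not> strictly_dominated ?R lam" using min R cR by (auto simp: minimal_constituent_def)
    ultimately show "lam = ?R" by (auto simp: strictly_dominated_def)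
  next
    assume eq: "lam = ?R"
    have "?c mu = 0" if mu: "partition_of (m * n) mu" "strictly_dominated mu ?R" for mu
    proof (rule ccontr)
      assume "?c mu \<noteq> 0"
      then have "dominated ?R mu" by (rule rectangle_dominated[OF mu(1)])
      then have "mu = ?R"
        using mu R by (intro dominated_antisym) (auto simp: strictly_dominated_def partition_of_def)
      then show False using mu(2) by (simp add: strictly_dominated_def)
    qed
    then show "minimal_constituent (m * n) (foulkes_char m n) lam"
      using cR eq by (simp add: minimal_constituent_def)
  qed
next
  fix lam
  assume m: "odd m" and lam: "partition_of (m * n) lam"
  let ?c = "\<lambda>mu. char_inner (m * n) (foulkes_char m n) (irr_char mu)"
  let ?Q = "\<lambda>mu. \<exists>F. set_family m n F \<and> has_type F mu"
  have part: "is_partition lam" "sum_list lam = m * n" using lam by (auto simp: partition_of_def)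
  show "minimal_constituent (m * n) (foulkes_char m n) lam \<longleftrightarrow> (\<exists>F. minimal_set_family m n F lam)"
  proof
    assume min: "minimal_constituent (m * n) (foulkes_char m n) lam"
    then have "?c lam \<noteq> 0" by (simp add: minimal_constituent_def)
    then obtain F where F: "set_family m n F" "has_type F lam"
      using set_family_of_foulkes_constituent[OF m lam] by blast
    have "\<not> (\<exists>G mu. is_partition mu \<and> strictly_dominated mu lam \<and> set_family m n G \<and> has_type G mu)"
    proof
      assume "\<exists>G mu. is_partition mu \<and> strictly_dominated mu lam \<and> set_family m n G \<and> has_type G mu"
      then obtain mu where mu: "is_partition mu" "strictly_dominated mu lam" "?Q mu" by blast
      \<comment> \<open>\<open>foulkes_constituent_of_minimal_family\<close> applies to minimal
        types only, so the descent from \<open>mu\<close> to a minimal type \<open>nu\<close> comes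
        before the contradiction.\<close>
      obtain nu where nu: "is_partition nu" "?Q nu" "dominated nu mu"
          "\<forall>rho. is_partition rho \<longrightarrow> strictly_dominated rho nu \<longrightarrow> \<not> ?Q rho"
        using exists_minimal_below[of mu ?Q] mu(1,3) by blast
      have lower: "strictly_dominated nu lam"
        by (rule strictly_dominated_trans[OF part(1) mu(1) nu(3) mu(2)])
      then have pnu: "partition_of (m * n) nu"
        using nu(1) part(2) by (simp add: partition_of_def strictly_dominated_def dominated_def)
      obtain G where "minimal_set_family m n G nu"
        using nu(2,4) unfolding minimal_set_family_def by blast
      then have "1 \<le> ?c nu" by (rule foulkes_constituent_of_minimal_family[OF m pnu])
      moreover have "?c nu = 0" using min pnu lower by (simp add: minimal_constituent_def)
      ultimately show False by simp
    qed
    then show "\<exists>F. minimal_set_family m n F lam" using F unfolding minimal_set_family_def by blast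
  next
    assume "\<exists>F. minimal_set_family m n F lam"
    then obtain F where F: "minimal_set_family m n F lam" by blast
    have "1 \<le> ?c lam" by (rule foulkes_constituent_of_minimal_family[OF m lam F])
    moreover have "?c mu = 0" if mu: "partition_of (m * n) mu" "strictly_dominated mu lam" for mu
    proof (rule ccontr)
      assume "?c mu \<noteq> 0"
      then have "?Q mu" by (rule set_family_of_foulkes_constituent[OF m mu(1)])
      then show False using F mu unfolding minimal_set_family_def partition_of_def by blast
    qed
    ultimately show "minimal_constituent (m * n) (foulkes_char m n) lam"
      by (simp add: minimal_constituent_def)
  qed
qed

end
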